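(* Let $f,g:[a,b]\to\mathbb{R}$ be regulated on $[a,b]$ and suppose that at least one of them has bounded variation on $[a,b]$. Then the Kurzweil-Stieltjes integral $(\mathrm{K})\int_a^b f\,\mathrm{d}g$, the Young integral $(\mathrm{Y})\int_a^b f\,\mathrm{d}g$ and the Dushnik integral $(\mathrm{D})\int_a^b f\,\mathrm{d}g$ all exist, and $$(\mathrm{K})\int_a^b f\,\mathrm{d}g=(\mathrm{Y})\int_a^b f\,\mathrm{d}g=f(b)\,g(b)-f(a)\,g(a)-(\mathrm{D})\int_a^b g\,\mathrm{d}f .$$
   Context: Here $-\infty<a<b<\infty$. A function $h:[a,b]\to\mathbb{R}$ is regulated if it has finite one-sided limits $h(t-)=\lim_{\tau\to t-}h(\tau)$ for all $t\in(a,b]$ and $h(s+)=\lim_{\tau\to s+}h(\tau)$ for all $s\in[a,b)$. For regulated $h$ put $\Delta^-h(t)=h(t)-h(t-)$ for $t\in(a,b]$ and $\Delta^+h(s)=h(s+)-h(s)$ for $s\in[a,b)$. A division of $[a,b]$ is a finite sequence $\alpha=\{\alpha_0,\dots,\alpha_\nu\}$ with $a=\alpha_0<\alpha_1<\dots<\alpha_\nu=b$. A partition of $[a,b]$ is a pair $P=(\alpha,\xi)$ where $\alpha$ is a division of $[a,b]$ and $\xi=\{\xi_1,\dots,\xi_\nu\}$ satisfies $\xi_j\in[\alpha_{j-1},\alpha_j]$ for all $j$. For divisions, $\alpha\supset\beta$ means inclusion of the sets of points. For $f,g:[a,b]\to\mathbb{R}$ and a partition $P=(\alpha,\xi)$ put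 $$S(f,\mathrm{d}g,P)=\sum_{j=1}^{\nu}f(\xi_j)\,[g(\alpha_j)-g(\alpha_{j-1})],$$ and, if $g$ is regulated, $$S_Y(f,\mathrm{d}g,P)=\sum_{j=1}^{\nu}\Big(f(\alpha_{j-1})\,\Delta^+g(\alpha_{j-1})+f(\xi_j)\,[g(\alpha_j-)-g(\alpha_{j-1}+)]+f(\alpha_j)\,\Delta^-g(\alpha_j)\Big).$$ Young integral (for regulated $g$) and Dushnik integral: $(\mathrm{Y})\int_a^b f\,\mathrm{d}g$ (respectively $(\mathrm{D})\int_a^b f\,\mathrm{d}g$) exists and equals $I\in\mathbb{R}$ if for every $\varepsilon>0$ there is a division $\alpha_\varepsilon$ of $[a,b]$ such that $|S_Y(f,\mathrm{d}g,P)-I|<\varepsilon$ (respectively $|S(f,\mathrm{d}g,P)-I|<\varepsilon$) for all partitions $P=(\alpha,\xi)$ of $[a,b]$ with $\alpha\supset\alpha_\varepsilon$ and $\alpha_{j-1}<\xi_j<\alpha_j$ for all $j$. Kurzweil-Stieltjes integral: $(\mathrm{K})\int_a^b f\,\mathrm{d}g$ exists and equals $I\in\mathbb{R}$ if for every $\varepsilon>0$ there is a function $\delta_\varepsilon:[a,b]\to(0,1)$ such that $|S(f,\mathrm{d}g,P)-I|<\varepsilon$ for all partitions $P=(\alpha,\xi)$ of $[a,b]$ with $[\alpha_{j-1},\alpha_j]\subset[\xi_j-\delta_\varepsilon(\xi_j),\xi_j+\delta_\varepsilon(\xi_j)]$ for all $j$. *)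

theory Defs
  imports "HOL-Analysis.Analysis"
begin

(* A function h on [a,b] is represented by a total function of type real => real.
   Nothing below depends on its values outside [a,b]: left limits are only taken at
   points of (a,b] and right limits only at points of [a,b). *)

definition regulated_on :: "real \<Rightarrow> real \<Rightarrow> (real \<Rightarrow> real) \<Rightarrow> bool" where
  "regulated_on a b h \<longleftrightarrow>
     (\<forall>t\<in>{a<..b}. \<exists>l. (h \<longlongrightarrow> l) (at_left t)) \<and>
     (\<forall>s\<in>{a..<b}. \<exists>l. (h \<longlongrightarrow> l) (at_right s))"

definition left_lim :: "(real \<Rightarrow> real) \<Rightarrow> real \<Rightarrow> real" where
  "left_lim h t = Lim (at_left t) h"

definition right_lim :: "(real \<Rightarrow> real) \<Rightarrow> real \<Rightarrow> real" where
  "right_lim h s = Lim (at_right s) h"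

definition left_jump :: "(real \<Rightarrow> real) \<Rightarrow> real \<Rightarrow> real" where
  "left_jump h t = h t - left_lim h t"

definition right_jump :: "(real \<Rightarrow> real) \<Rightarrow> real \<Rightarrow> real" where
  "right_jump h s = right_lim h s - h s"

(* The finite sequences alpha_0, ..., alpha_nu and xi_1, ..., xi_nu are represented by
   their length nu and functions on nat of which only the indices 0..nu and 1..nu,
   respectively, are ever used. *)

definition is_division :: "real \<Rightarrow> real \<Rightarrow> nat \<Rightarrow> (nat \<Rightarrow> real) \<Rightarrow> bool" where
  "is_division a b \<nu> \<alpha> \<longleftrightarrow>
     \<alpha> 0 = a \<and> \<alpha> \<nu> = b \<and> (\<forall>j\<in>{1..\<nu>}. \<alpha> (j - 1) < \<alpha> j)"

definition is_partition ::
    "real \<Rightarrow> real \<Rightarrow> nat \<Rightarrow> (nat \<Rightarrow> real) \<Rightarrow> (nat \<Rightarrow> real) \<Rightarrow> bool" where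
  "is_partition a b \<nu> \<alpha> \<xi> \<longleftrightarrow>
     is_division a b \<nu> \<alpha> \<and> (\<forall>j\<in>{1..\<nu>}. \<xi> j \<in> {\<alpha> (j - 1)..\<alpha> j})"

definition has_bounded_variation :: "real \<Rightarrow> real \<Rightarrow> (real \<Rightarrow> real) \<Rightarrow> bool" where
  "has_bounded_variation a b h \<longleftrightarrow>
     (\<exists>M. \<forall>\<nu> \<alpha>. is_division a b \<nu> \<alpha> \<longrightarrow> (\<Sum>j=1..\<nu>. \<bar>h (\<alpha> j) - h (\<alpha> (j - 1))\<bar>) \<le> M)"

definition stieltjes_sum ::
    "(real \<Rightarrow> real) \<Rightarrow> (real \<Rightarrow> real) \<Rightarrow> nat \<Rightarrow> (nat \<Rightarrow> real) \<Rightarrow> (nat \<Rightarrow> real) \<Rightarrow> real" where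
  "stieltjes_sum f g \<nu> \<alpha> \<xi> = (\<Sum>j=1..\<nu>. f (\<xi> j) * (g (\<alpha> j) - g (\<alpha> (j - 1))))"

definition young_sum ::
    "(real \<Rightarrow> real) \<Rightarrow> (real \<Rightarrow> real) \<Rightarrow> nat \<Rightarrow> (nat \<Rightarrow> real) \<Rightarrow> (nat \<Rightarrow> real) \<Rightarrow> real" where
  "young_sum f g \<nu> \<alpha> \<xi> =
     (\<Sum>j=1..\<nu>. f (\<alpha> (j - 1)) * right_jump g (\<alpha> (j - 1))
               + f (\<xi> j) * (left_lim g (\<alpha> j) - right_lim g (\<alpha> (j - 1)))
               + f (\<alpha> j) * left_jump g (\<alpha> j))"

(* Meaningful for g regulated on [a,b] only; otherwise the one-sided limits in
   young_sum need not exist. *)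
definition has_young_integral ::
    "real \<Rightarrow> real \<Rightarrow> (real \<Rightarrow> real) \<Rightarrow> (real \<Rightarrow> real) \<Rightarrow> real \<Rightarrow> bool" where
  "has_young_integral a b f g I \<longleftrightarrow>
     (\<forall>\<epsilon>>0. \<exists>\<mu> \<beta>. is_division a b \<mu> \<beta> \<and>
        (\<forall>\<nu> \<alpha> \<xi>. is_partition a b \<nu> \<alpha> \<xi> \<and> \<beta> ` {0..\<mu>} \<subseteq> \<alpha> ` {0..\<nu>} \<and>
            (\<forall>j\<in>{1..\<nu>}. \<alpha> (j - 1) < \<xi> j \<and> \<xi> j < \<alpha> j) \<longrightarrow>
            \<bar>young_sum f g \<nu> \<alpha> \<xi> - I\<bar> < \<epsilon>))"

definition has_dushnik_integral ::
    "real \<Rightarrow> real \<Rightarrow> (real \<Rightarrow> real) \<Rightarrow> (real \<Rightarrow> real) \<Rightarrow> real \<Rightarrow> bool" where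
  "has_dushnik_integral a b f g I \<longleftrightarrow>
     (\<forall>\<epsilon>>0. \<exists>\<mu> \<beta>. is_division a b \<mu> \<beta> \<and>
        (\<forall>\<nu> \<alpha> \<xi>. is_partition a b \<nu> \<alpha> \<xi> \<and> \<beta> ` {0..\<mu>} \<subseteq> \<alpha> ` {0..\<nu>} \<and>
            (\<forall>j\<in>{1..\<nu>}. \<alpha> (j - 1) < \<xi> j \<and> \<xi> j < \<alpha> j) \<longrightarrow>
            \<bar>stieltjes_sum f g \<nu> \<alpha> \<xi> - I\<bar> < \<epsilon>))"

definition has_ks_integral ::
    "real \<Rightarrow> real \<Rightarrow> (real \<Rightarrow> real) \<Rightarrow> (real \<Rightarrow> real) \<Rightarrow> real \<Rightarrow> bool" where
  "has_ks_integral a b f g I \<longleftrightarrow>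
     (\<forall>\<epsilon>>0. \<exists>\<delta>::real \<Rightarrow> real. (\<forall>t\<in>{a..b}. 0 < \<delta> t \<and> \<delta> t < 1) \<and>
        (\<forall>\<nu> \<alpha> \<xi>. is_partition a b \<nu> \<alpha> \<xi> \<and>
            (\<forall>j\<in>{1..\<nu>}. {\<alpha> (j - 1)..\<alpha> j} \<subseteq> {\<xi> j - \<delta> (\<xi> j)..\<xi> j + \<delta> (\<xi> j)}) \<longrightarrow>
            \<bar>stieltjes_sum f g \<nu> \<alpha> \<xi> - I\<bar> < \<epsilon>))"

definition young_integrable ::
    "real \<Rightarrow> real \<Rightarrow> (real \<Rightarrow> real) \<Rightarrow> (real \<Rightarrow> real) \<Rightarrow> bool" where
  "young_integrable a b f g \<longleftrightarrow> (\<exists>I. has_young_integral a b f g I)"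

definition dushnik_integrable ::
    "real \<Rightarrow> real \<Rightarrow> (real \<Rightarrow> real) \<Rightarrow> (real \<Rightarrow> real) \<Rightarrow> bool" where
  "dushnik_integrable a b f g \<longleftrightarrow> (\<exists>I. has_dushnik_integral a b f g I)"

definition ks_integrable ::
    "real \<Rightarrow> real \<Rightarrow> (real \<Rightarrow> real) \<Rightarrow> (real \<Rightarrow> real) \<Rightarrow> bool" where
  "ks_integrable a b f g \<longleftrightarrow> (\<exists>I. has_ks_integral a b f g I)"

definition young_integral ::
    "real \<Rightarrow> real \<Rightarrow> (real \<Rightarrow> real) \<Rightarrow> (real \<Rightarrow> real) \<Rightarrow> real" where
  "young_integral a b f g = (THE I. has_young_integral a b f g I)"

definition dushnik_integral ::
    "real \<Rightarrow> real \<Rightarrow> (real \<Rightarrow> real) \<Rightarrow> (real \<Rightarrow> real) \<Rightarrow> real" where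
  "dushnik_integral a b f g = (THE I. has_dushnik_integral a b f g I)"

definition ks_integral ::
    "real \<Rightarrow> real \<Rightarrow> (real \<Rightarrow> real) \<Rightarrow> (real \<Rightarrow> real) \<Rightarrow> real" where
  "ks_integral a b f g = (THE I. has_ks_integral a b f g I)"

end

theory Submission
  imports Defs
begin

text \<open>
  All three integrals are limits of sums along filters of partitions. If one function has bounded
  variation, the Stieltjes sums are bounded, uniformly in the partition, by the supremum norm of the
  other one, so by uniform approximation with step functions it suffices to treat indicators of rays
  against a regulated function. For these the sums telescope, and the Kurzweil-Stieltjes integral of
  \<open>f\<close> against \<open>g\<close> is seen to complement the Dushnik integral of \<open>g\<close> against \<open>f\<close>. The Young
  integral reduces to that Dushnik integral by summation by parts.
\<close>

section \<open>Divisions and partitions\<close>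

text \<open>The two modes of convergence treat a point of discontinuity in opposite ways: a gauge
  can force it to be a tag, whereas a Dushnik partition can be made to contain it as a division
  point and then never has it as a tag. A jump of a step function is thus weighted with a value of
  the other function in one mode and with a one-sided limit in the other. Summation by parts
  exchanges tags and division points, which is why the Kurzweil-Stieltjes integral in one order is
  tied to the Dushnik integral in the opposite order. This relation is linear in each function and
  survives uniform limits, so no formula for the integrals of general regulated functions is
  required. It is not symmetric; both orders are carried along, which settles the two alternatives
  of the variation hypothesis alike and also yields the Dushnik integral of \<open>f\<close> against
  \<open>g\<close>. The function of bounded variation stays fixed while the other one is
  approximated, as integrand and as integrator, so the sums have to be bounded in both
  positions.\<close>

lemma division_less:
  assumes "is_division a b \<nu> \<alpha>" "i < j" "j \<le> \<nu>"
  shows "\<alpha> i < \<alpha> j"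
  using assms(2,3)
proof (induction j)
  case (Suc j)
  have "\<alpha> j < \<alpha> (Suc j)"
    using assms(1) Suc.prems by (force simp: is_division_def)
  with Suc show ?case
    by (cases "i = j") auto
qed simp

lemma division_le:
  assumes "is_division a b \<nu> \<alpha>" "i \<le> j" "j \<le> \<nu>"
  shows "\<alpha> i \<le> \<alpha> j"
  using division_less[OF assms(1)] assms(2,3) by (cases "i = j") (auto simp: less_imp_le)

lemma division_mem:
  assumes "is_division a b \<nu> \<alpha>" "j \<le> \<nu>"
  shows "\<alpha> j \<in> {a..b}"
  using division_le[OF assms(1), of 0 j] division_le[OF assms(1), of j \<nu>] assms
  by (auto simp: is_division_def)

lemma partition_division: "is_partition a b \<nu> \<alpha> \<xi> \<Longrightarrow> is_division a b \<nu> \<alpha>"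
  by (simp add: is_partition_def)

lemma partition_tag:
  assumes "is_partition a b \<nu> \<alpha> \<xi>" "j \<in> {1..\<nu>}"
  shows "\<alpha> (j - 1) \<le> \<xi> j" "\<xi> j \<le> \<alpha> j"
  using assms by (auto simp: is_partition_def)

lemma partition_tag_mem:
  assumes "is_partition a b \<nu> \<alpha> \<xi>" "j \<in> {1..\<nu>}"
  shows "\<xi> j \<in> {a..b}"
proof -
  have "j - 1 \<le> \<nu>" "j \<le> \<nu>"
    using assms(2) by auto
  then have "\<alpha> (j - 1) \<in> {a..b}" "\<alpha> j \<in> {a..b}"
    using division_mem[OF partition_division[OF assms(1)]] by blast+
  then show ?thesis
    using partition_tag[OF assms] by auto
qed

text \<open>Consecutive tags are separated by a division point. Monotonicity lets the tags act as
  division points after summation by parts, and makes the tags inside an upward ray a final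
  segment.\<close>

lemma partition_tag_mono:
  assumes "is_partition a b \<nu> \<alpha> \<xi>" "1 \<le> i" "i \<le> j" "j \<le> \<nu>"
  shows "\<xi> i \<le> \<xi> j"
proof (cases "i = j")
  case False
  then have "\<xi> i \<le> \<alpha> i" "\<alpha> i \<le> \<alpha> (j - 1)" "\<alpha> (j - 1) \<le> \<xi> j"
    using assms partition_tag[OF assms(1), of i] partition_tag[OF assms(1), of j]
      division_le[OF partition_division[OF assms(1)], of i "j - 1"]
    by auto
  then show ?thesis by linarith
qed simp

lemma division_length_pos:
  assumes "is_division a b \<nu> \<alpha>" "a < b"
  shows "1 \<le> \<nu>"
  using assms by (cases \<nu>) (auto simp: is_division_def)

lemma ex_division_points:
  assumes "a < b" "finite B" "B \<subseteq> {a..b}"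
  obtains \<mu> \<beta> where "is_division a b \<mu> \<beta>" "B \<subseteq> \<beta> ` {0..\<mu>}"
proof -
  define xs where "xs = sorted_list_of_set (insert a (insert b B))"
  have set: "set xs = insert a (insert b B)"
    using assms by (simp only: xs_def set_sorted_list_of_set finite_insert)
  have ss: "sorted_wrt (<) xs"
    by (simp add: xs_def)
  have ne: "length xs > 0"
    using set by (cases xs) auto
  have mono: "xs ! i \<le> xs ! j" if "i \<le> j" "j < length xs" for i j
    using sorted_wrt_nth_less[OF ss, of i j] that by (cases "i = j") auto
  have rng: "xs ! i \<in> {a..b}" if "i < length xs" for i
    using nth_mem[OF that] set assms by auto
  have surj: "\<exists>i\<in>{0..length xs - 1}. xs ! i = x" if "x \<in> insert a (insert b B)" for x
  proof -
    have "x \<in> set xs"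
      using that set by blast
    then obtain i where "i < length xs" "xs ! i = x"
      by (auto simp: in_set_conv_nth)
    then show ?thesis
      by (intro bexI[of _ i]) auto
  qed
  obtain i where i: "i \<le> length xs - 1" "xs ! i = a"
    using surj[of a] by auto
  obtain k where k: "k \<le> length xs - 1" "xs ! k = b"
    using surj[of b] by auto
  have "xs ! 0 = a"
  proof -
    have "i < length xs"
      using i(1) ne by linarith
    then show ?thesis
      using mono[of 0 i] rng[of 0] i ne by simp
  qed
  moreover have "xs ! (length xs - 1) = b"
    using mono[of k "length xs - 1"] rng[of "length xs - 1"] k ne by auto
  moreover have "xs ! (j - 1) < xs ! j" if "j \<in> {1..length xs - 1}" for j
    using that ne by (intro sorted_wrt_nth_less[OF ss]) auto
  ultimately have "is_division a b (length xs - 1) (nth xs)"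
    by (auto simp: is_division_def)
  moreover have "B \<subseteq> nth xs ` {0..length xs - 1}"
  proof
    fix x assume "x \<in> B"
    then show "x \<in> nth xs ` {0..length xs - 1}"
      using surj[of x] by auto
  qed
  ultimately show ?thesis
    by (rule that)
qed

text \<open>One formula serves division points and tags: the second sequence is read from index 1
  on, its division point of index 0 being the joint, which \<open>\<alpha> m\<close> already
  supplies.\<close>

definition splice_at :: "nat \<Rightarrow> (nat \<Rightarrow> real) \<Rightarrow> (nat \<Rightarrow> real) \<Rightarrow> nat \<Rightarrow> real" where
  "splice_at m \<alpha> \<beta> j = (if j \<le> m then \<alpha> j else \<beta> (j - m))"

text \<open>A case rule, since every property of a concatenation needed later is a property of
  single tagged cells, and each such cell comes from one of the two pieces.\<close>

lemma splice_at_cell: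
  assumes "\<alpha> m = \<beta> 0" "j \<in> {1..m + n}"
  obtains "j \<in> {1..m}" "splice_at m \<alpha> \<beta> (j - 1) = \<alpha> (j - 1)" "splice_at m \<alpha> \<beta> j = \<alpha> j"
      "splice_at m \<xi> \<eta> j = \<xi> j"
  | k where "k \<in> {1..n}" "splice_at m \<alpha> \<beta> (j - 1) = \<beta> (k - 1)" "splice_at m \<alpha> \<beta> j = \<beta> k"
      "splice_at m \<xi> \<eta> j = \<eta> k"
proof (cases "j \<le> m")
  case True
  then show ?thesis
    using assms by (intro that(1)) (auto simp: splice_at_def)
next
  case False
  \<comment> \<open>For \<open>j = Suc m\<close> the left end is stored as
    \<open>\<alpha> m\<close>; only here is the joint condition used.\<close>
  then have "splice_at m \<alpha> \<beta> (j - 1) = \<beta> (j - m - 1)"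
    using assms by (cases "j = Suc m") (auto simp: splice_at_def)
  then show ?thesis
    using False assms by (intro that(2)[of "j - m"]) (auto simp: splice_at_def)
qed

lemma partition_splice:
  assumes "is_partition a b m \<alpha> \<xi>" "is_partition b c n \<beta> \<eta>"
  shows "is_partition a c (m + n) (splice_at m \<alpha> \<beta>) (splice_at m \<xi> \<eta>)"
proof -
  have joint: "\<alpha> m = \<beta> 0"
    using assms by (auto simp: is_partition_def is_division_def)
  have "splice_at m \<alpha> \<beta> (j - 1) < splice_at m \<alpha> \<beta> j \<and>
      splice_at m \<xi> \<eta> j \<in> {splice_at m \<alpha> \<beta> (j - 1)..splice_at m \<alpha> \<beta> j}"
    if "j \<in> {1..m + n}" for j
  proof (rule splice_at_cell[of \<alpha> m \<beta> j n \<xi> \<eta>, OF joint that], goal_cases)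
    case 1
    then show ?case
      using assms(1) by (simp only: is_partition_def is_division_def)
  next
    case (2 k)
    then show ?case
      using assms(2) by (simp only: is_partition_def is_division_def)
  qed
  moreover have "splice_at m \<alpha> \<beta> 0 = a" "splice_at m \<alpha> \<beta> (m + n) = c"
    using assms joint by (auto simp: splice_at_def is_partition_def is_division_def)
  ultimately show ?thesis
    by (simp add: is_partition_def is_division_def)
qed

section \<open>The two modes of convergence as filters\<close>

definition gauge_on :: "real \<Rightarrow> real \<Rightarrow> (real \<Rightarrow> real) \<Rightarrow> bool" where
  "gauge_on a b \<delta> \<longleftrightarrow> (\<forall>t\<in>{a..b}. 0 < \<delta> t \<and> \<delta> t < 1)"

definition fine_partition ::
    "real \<Rightarrow> real \<Rightarrow> (real \<Rightarrow> real) \<Rightarrow> nat \<Rightarrow> (nat \<Rightarrow> real) \<Rightarrow> (nat \<Rightarrow> real) \<Rightarrow> bool" where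
  "fine_partition a b \<delta> \<nu> \<alpha> \<xi> \<longleftrightarrow> is_partition a b \<nu> \<alpha> \<xi> \<and>
     (\<forall>j\<in>{1..\<nu>}. {\<alpha> (j - 1)..\<alpha> j} \<subseteq> {\<xi> j - \<delta> (\<xi> j)..\<xi> j + \<delta> (\<xi> j)})"

definition interior_partition ::
    "real \<Rightarrow> real \<Rightarrow> real set \<Rightarrow> nat \<Rightarrow> (nat \<Rightarrow> real) \<Rightarrow> (nat \<Rightarrow> real) \<Rightarrow> bool" where
  "interior_partition a b B \<nu> \<alpha> \<xi> \<longleftrightarrow> is_partition a b \<nu> \<alpha> \<xi> \<and> B \<subseteq> \<alpha> ` {0..\<nu>} \<and>
     (\<forall>j\<in>{1..\<nu>}. \<alpha> (j - 1) < \<xi> j \<and> \<xi> j < \<alpha> j)"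

definition ks_filter :: "real \<Rightarrow> real \<Rightarrow> (nat \<times> (nat \<Rightarrow> real) \<times> (nat \<Rightarrow> real)) filter" where
  "ks_filter a b = (INF \<delta>\<in>Collect (gauge_on a b).
     principal {(\<nu>, \<alpha>, \<xi>). fine_partition a b \<delta> \<nu> \<alpha> \<xi>})"

text \<open>Indexed by finite sets rather than divisions, because unions then show at once that the
  base is directed; no merging of two increasing sequences is required.\<close>

definition dushnik_filter :: "real \<Rightarrow> real \<Rightarrow> (nat \<times> (nat \<Rightarrow> real) \<times> (nat \<Rightarrow> real)) filter" where
  "dushnik_filter a b = (INF B\<in>{B. finite B \<and> B \<subseteq> {a..b}}.
     principal {(\<nu>, \<alpha>, \<xi>). interior_partition a b B \<nu> \<alpha> \<xi>})"

text \<open>A single gauge suffices because the pointwise minimum of two gauges is a gauge, and a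
  partition fine for it is fine for both.\<close>

lemma eventually_ks_filter:
  "eventually (\<lambda>(\<nu>, \<alpha>, \<xi>). Q \<nu> \<alpha> \<xi>) (ks_filter a b) \<longleftrightarrow>
     (\<exists>\<delta>. gauge_on a b \<delta> \<and> (\<forall>\<nu> \<alpha> \<xi>. fine_partition a b \<delta> \<nu> \<alpha> \<xi> \<longrightarrow> Q \<nu> \<alpha> \<xi>))"
  unfolding ks_filter_def
proof (subst eventually_INF_base)
  show "Collect (gauge_on a b) \<noteq> {}"
    by (auto simp: gauge_on_def intro!: exI[of _ "\<lambda>_. 1 / 2"])
next
  fix \<delta> \<delta>' assume "\<delta> \<in> Collect (gauge_on a b)" "\<delta>' \<in> Collect (gauge_on a b)"
  then have "gauge_on a b (\<lambda>t. min (\<delta> t) (\<delta>' t))"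
    by (auto simp: gauge_on_def)
  moreover have "fine_partition a b \<delta> \<nu> \<alpha> \<xi> \<and> fine_partition a b \<delta>' \<nu> \<alpha> \<xi>"
    if "fine_partition a b (\<lambda>t. min (\<delta> t) (\<delta>' t)) \<nu> \<alpha> \<xi>" for \<nu> \<alpha> \<xi>
  proof -
    have "{x - min (\<delta> x) (\<delta>' x)..x + min (\<delta> x) (\<delta>' x)} \<subseteq> {x - \<delta> x..x + \<delta> x} \<inter> {x - \<delta>' x..x + \<delta>' x}"
      for x
      by auto
    with that show ?thesis
      unfolding fine_partition_def by (meson le_inf_iff subset_trans)
  qed
  ultimately show "\<exists>\<delta>''\<in>Collect (gauge_on a b).
      principal {(\<nu>, \<alpha>, \<xi>). fine_partition a b \<delta>'' \<nu> \<alpha> \<xi>}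
      \<le> inf (principal {(\<nu>, \<alpha>, \<xi>). fine_partition a b \<delta> \<nu> \<alpha> \<xi>})
            (principal {(\<nu>, \<alpha>, \<xi>). fine_partition a b \<delta>' \<nu> \<alpha> \<xi>})"
    by (intro bexI[of _ "\<lambda>t. min (\<delta> t) (\<delta>' t)"]) auto
qed (auto simp: eventually_principal)

lemma eventually_dushnik_filter:
  "eventually (\<lambda>(\<nu>, \<alpha>, \<xi>). Q \<nu> \<alpha> \<xi>) (dushnik_filter a b) \<longleftrightarrow>
     (\<exists>B. finite B \<and> B \<subseteq> {a..b} \<and> (\<forall>\<nu> \<alpha> \<xi>. interior_partition a b B \<nu> \<alpha> \<xi> \<longrightarrow> Q \<nu> \<alpha> \<xi>))"
  unfolding dushnik_filter_def
proof (subst eventually_INF_base)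
  fix B C assume "B \<in> {B. finite B \<and> B \<subseteq> {a..b}}" "C \<in> {B. finite B \<and> B \<subseteq> {a..b}}"
  then show "\<exists>D\<in>{B. finite B \<and> B \<subseteq> {a..b}}.
      principal {(\<nu>, \<alpha>, \<xi>). interior_partition a b D \<nu> \<alpha> \<xi>}
      \<le> inf (principal {(\<nu>, \<alpha>, \<xi>). interior_partition a b B \<nu> \<alpha> \<xi>})
            (principal {(\<nu>, \<alpha>, \<xi>). interior_partition a b C \<nu> \<alpha> \<xi>})"
    by (intro bexI[of _ "B \<union> C"]) (auto simp: interior_partition_def)
qed (auto simp: eventually_principal)

section \<open>Existence of admissible partitions, so that limits along both filters are
  unique\<close>

lemma ex_interior_partition:
  assumes "a < b" "finite B" "B \<subseteq> {a..b}"
  shows "\<exists>\<nu> \<alpha> \<xi>. interior_partition a b B \<nu> \<alpha> \<xi>"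
proof -
  obtain \<nu> \<alpha> where d: "is_division a b \<nu> \<alpha>" "B \<subseteq> \<alpha> ` {0..\<nu>}"
    using ex_division_points[OF assms] .
  have less: "\<alpha> (j - 1) < \<alpha> j" if "j \<in> {1..\<nu>}" for j
    using d(1) that by (auto simp: is_division_def)
  have "interior_partition a b B \<nu> \<alpha> (\<lambda>j. (\<alpha> (j - 1) + \<alpha> j) / 2)"
    unfolding interior_partition_def is_partition_def
    using d less by (auto simp: less_imp_le)
  then show ?thesis by blast
qed

lemma dushnik_filter_nonbot:
  assumes "a < b"
  shows "dushnik_filter a b \<noteq> bot"
proof
  assume "dushnik_filter a b = bot"
  then have "eventually (\<lambda>(\<nu>, \<alpha>, \<xi>). False) (dushnik_filter a b)"
    by simp
  then show False
    unfolding eventually_dushnik_filter using ex_interior_partition[OF assms] by blast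
qed

text \<open>Cousin's lemma, by bisection: fine partitions of adjacent intervals concatenate, and a
  short interval around \<open>x\<close> is a single fine cell with tag \<open>x\<close>.\<close>

lemma ex_fine_partition:
  assumes "a \<le> b" "gauge_on a b \<delta>"
  shows "\<exists>\<nu> \<alpha> \<xi>. fine_partition a b \<delta> \<nu> \<alpha> \<xi>"
  using assms(1)
proof (rule Bolzano[where P = "\<lambda>u v. \<exists>\<nu> \<alpha> \<xi>. fine_partition u v \<delta> \<nu> \<alpha> \<xi>"])
  fix u v w
  assume "\<exists>\<nu> \<alpha> \<xi>. fine_partition u v \<delta> \<nu> \<alpha> \<xi>" "\<exists>\<nu> \<alpha> \<xi>. fine_partition v w \<delta> \<nu> \<alpha> \<xi>"
  then obtain m \<alpha> \<xi> n \<beta> \<eta>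
    where f: "fine_partition u v \<delta> m \<alpha> \<xi>" "fine_partition v w \<delta> n \<beta> \<eta>"
    by blast
  then have p: "is_partition u v m \<alpha> \<xi>" "is_partition v w n \<beta> \<eta>"
    by (auto simp: fine_partition_def)
  then have joint: "\<alpha> m = \<beta> 0"
    by (auto simp: is_partition_def is_division_def)
  have "{splice_at m \<alpha> \<beta> (j - 1)..splice_at m \<alpha> \<beta> j}
      \<subseteq> {splice_at m \<xi> \<eta> j - \<delta> (splice_at m \<xi> \<eta> j)..splice_at m \<xi> \<eta> j + \<delta> (splice_at m \<xi> \<eta> j)}"
    if "j \<in> {1..m + n}" for j
  proof (rule splice_at_cell[of \<alpha> m \<beta> j n \<xi> \<eta>, OF joint that], goal_cases)
    case 1
    then show ?case
      using f(1) by (simp only: fine_partition_def)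
  next
    case (2 k)
    then show ?case
      using f(2) by (simp only: fine_partition_def)
  qed
  then have "fine_partition u w \<delta> (m + n) (splice_at m \<alpha> \<beta>) (splice_at m \<xi> \<eta>)"
    using partition_splice[OF p] by (simp add: fine_partition_def)
  then show "\<exists>\<nu> \<alpha> \<xi>. fine_partition u w \<delta> \<nu> \<alpha> \<xi>"
    by blast
next
  fix x assume x: "a \<le> x" "x \<le> b"
  show "\<exists>d>0. \<forall>u v. u \<le> x \<and> x \<le> v \<and> v - u < d \<longrightarrow> (\<exists>\<nu> \<alpha> \<xi>. fine_partition u v \<delta> \<nu> \<alpha> \<xi>)"
  proof (intro exI[of _ "\<delta> x"] conjI allI impI)
    show "0 < \<delta> x"
      using assms(2) x by (auto simp: gauge_on_def)
    fix u v assume uv: "u \<le> x \<and> x \<le> v \<and> v - u < \<delta> x"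
    show "\<exists>\<nu> \<alpha> \<xi>. fine_partition u v \<delta> \<nu> \<alpha> \<xi>"
    \<comment> \<open>A degenerate interval has no strictly increasing division with a cell; its
      partition is the one of length 0.\<close>
    proof (cases "u = v")
      case True
      then have "fine_partition u v \<delta> 0 (\<lambda>_. u) (\<lambda>_. u)"
        by (simp add: fine_partition_def is_partition_def is_division_def)
      then show ?thesis by blast
    next
      case False
      then have "fine_partition u v \<delta> 1 (\<lambda>j. if j = 0 then u else v) (\<lambda>_. x)"
        using uv by (auto simp: fine_partition_def is_partition_def is_division_def)
      then show ?thesis by blast
    qed
  qed
qed

lemma ks_filter_nonbot:
  assumes "a \<le> b"
  shows "ks_filter a b \<noteq> bot"
proof
  assume "ks_filter a b = bot"
  then have "eventually (\<lambda>(\<nu>, \<alpha>, \<xi>). False) (ks_filter a b)"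
    by simp
  then show False
    unfolding eventually_ks_filter using ex_fine_partition[OF assms] by blast
qed

text \<open>Stated for arbitrary sums \<open>T\<close> because the Young and Dushnik integrals are
  limits along the same filter. A finite set is enlarged to a division, and the points of a division
  form a finite set.\<close>

lemma tendsto_dushnik_filter_iff:
  fixes T :: "nat \<Rightarrow> (nat \<Rightarrow> real) \<Rightarrow> (nat \<Rightarrow> real) \<Rightarrow> real"
  assumes "a < b"
  shows "((\<lambda>(\<nu>, \<alpha>, \<xi>). T \<nu> \<alpha> \<xi>) \<longlongrightarrow> I) (dushnik_filter a b) \<longleftrightarrow>
     (\<forall>\<epsilon>>0. \<exists>\<mu> \<beta>. is_division a b \<mu> \<beta> \<and>
        (\<forall>\<nu> \<alpha> \<xi>. is_partition a b \<nu> \<alpha> \<xi> \<and> \<beta> ` {0..\<mu>} \<subseteq> \<alpha> ` {0..\<nu>} \<and>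
            (\<forall>j\<in>{1..\<nu>}. \<alpha> (j - 1) < \<xi> j \<and> \<xi> j < \<alpha> j) \<longrightarrow>
            \<bar>T \<nu> \<alpha> \<xi> - I\<bar> < \<epsilon>))"
proof -
  have "(\<forall>\<^sub>F (\<nu>, \<alpha>, \<xi>) in dushnik_filter a b. \<bar>T \<nu> \<alpha> \<xi> - I\<bar> < \<epsilon>) \<longleftrightarrow>
     (\<exists>\<mu> \<beta>. is_division a b \<mu> \<beta> \<and>
        (\<forall>\<nu> \<alpha> \<xi>. interior_partition a b (\<beta> ` {0..\<mu>}) \<nu> \<alpha> \<xi> \<longrightarrow> \<bar>T \<nu> \<alpha> \<xi> - I\<bar> < \<epsilon>))"
    (is "_ \<longleftrightarrow> ?R") for \<epsilon>
    unfolding eventually_dushnik_filter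
  proof (intro iffI)
    assume "\<exists>B. finite B \<and> B \<subseteq> {a..b} \<and>
      (\<forall>\<nu> \<alpha> \<xi>. interior_partition a b B \<nu> \<alpha> \<xi> \<longrightarrow> \<bar>T \<nu> \<alpha> \<xi> - I\<bar> < \<epsilon>)"
    then obtain B where B: "finite B" "B \<subseteq> {a..b}"
      "\<And>\<nu> \<alpha> \<xi>. interior_partition a b B \<nu> \<alpha> \<xi> \<Longrightarrow> \<bar>T \<nu> \<alpha> \<xi> - I\<bar> < \<epsilon>"
      by blast
    obtain \<mu> \<beta> where "is_division a b \<mu> \<beta>" "B \<subseteq> \<beta> ` {0..\<mu>}"
      using ex_division_points[OF assms B(1,2)] .
    then show ?R
      using B(3) unfolding interior_partition_def by (meson subset_trans)
  next
    assume ?R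
    then obtain \<mu> \<beta> where "is_division a b \<mu> \<beta>"
      "\<And>\<nu> \<alpha> \<xi>. interior_partition a b (\<beta> ` {0..\<mu>}) \<nu> \<alpha> \<xi> \<Longrightarrow> \<bar>T \<nu> \<alpha> \<xi> - I\<bar> < \<epsilon>"
      by blast
    then show "\<exists>B. finite B \<and> B \<subseteq> {a..b} \<and>
      (\<forall>\<nu> \<alpha> \<xi>. interior_partition a b B \<nu> \<alpha> \<xi> \<longrightarrow> \<bar>T \<nu> \<alpha> \<xi> - I\<bar> < \<epsilon>)"
      using division_mem by (intro exI[of _ "\<beta> ` {0..\<mu>}"]) force
  qed
  then show ?thesis
    by (simp add: tendsto_iff dist_real_def interior_partition_def case_prod_unfold)
qed

definition stieltjes ::
    "(real \<Rightarrow> real) \<Rightarrow> (real \<Rightarrow> real) \<Rightarrow> nat \<times> (nat \<Rightarrow> real) \<times> (nat \<Rightarrow> real) \<Rightarrow> real" where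
  "stieltjes f g = (\<lambda>(\<nu>, \<alpha>, \<xi>). stieltjes_sum f g \<nu> \<alpha> \<xi>)"

lemma has_dushnik_integral_iff:
  assumes "a < b"
  shows "has_dushnik_integral a b f g I \<longleftrightarrow> (stieltjes f g \<longlongrightarrow> I) (dushnik_filter a b)"
  unfolding has_dushnik_integral_def stieltjes_def tendsto_dushnik_filter_iff[OF assms] ..

lemma has_young_integral_iff:
  assumes "a < b"
  shows "has_young_integral a b f g I \<longleftrightarrow>
    ((\<lambda>(\<nu>, \<alpha>, \<xi>). young_sum f g \<nu> \<alpha> \<xi>) \<longlongrightarrow> I) (dushnik_filter a b)"
  unfolding has_young_integral_def tendsto_dushnik_filter_iff[OF assms] ..

lemma has_ks_integral_iff:
  "has_ks_integral a b f g I \<longleftrightarrow> (stieltjes f g \<longlongrightarrow> I) (ks_filter a b)"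
proof -
  have "dist (stieltjes f g P) I < \<epsilon> \<longleftrightarrow> (case P of (\<nu>, \<alpha>, \<xi>) \<Rightarrow> \<bar>stieltjes_sum f g \<nu> \<alpha> \<xi> - I\<bar> < \<epsilon>)"
    for P \<epsilon>
    by (simp add: stieltjes_def dist_real_def split: prod.split)
  then show ?thesis
    by (simp add: tendsto_iff eventually_ks_filter has_ks_integral_def gauge_on_def
        fine_partition_def)
qed

section \<open>Stieltjes sums\<close>

lemma stieltjes_add_left:
  "stieltjes (\<lambda>t. f t + f' t) g = (\<lambda>P. stieltjes f g P + stieltjes f' g P)"
  by (auto simp: stieltjes_def stieltjes_sum_def distrib_right sum.distrib)

lemma stieltjes_add_right:
  "stieltjes f (\<lambda>t. g t + g' t) = (\<lambda>P. stieltjes f g P + stieltjes f g' P)"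
  by (auto simp: stieltjes_def stieltjes_sum_def add_diff_add distrib_left sum.distrib)

lemma stieltjes_cmult_left: "stieltjes (\<lambda>t. k * f t) g = (\<lambda>P. k * stieltjes f g P)"
  by (auto simp: stieltjes_def stieltjes_sum_def sum_distrib_left ac_simps)

lemma stieltjes_cmult_right: "stieltjes f (\<lambda>t. k * g t) = (\<lambda>P. k * stieltjes f g P)"
  by (auto simp: stieltjes_def stieltjes_sum_def sum_distrib_left algebra_simps)

lemma sum_telescope_from_1:
  fixes h :: "nat \<Rightarrow> real"
  shows "(\<Sum>j=1..n. h j - h (j - 1)) = h n - h 0"
  using sum_telescope''[of 0 n h] by simp

section \<open>Uniform bounds for Stieltjes sums from bounded variation\<close>

lemma bounded_variation_majorant:
  assumes "has_bounded_variation a b g"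
  obtains V where "\<And>x y. a \<le> x \<Longrightarrow> x \<le> y \<Longrightarrow> y \<le> b \<Longrightarrow> \<bar>g y - g x\<bar> \<le> V y - V x"
proof -
  \<comment> \<open>The majorant is the variation function: its value at \<open>x\<close> is the
    supremum of \<open>A x\<close>, the variation of \<open>g\<close> over
    \<open>[a, x]\<close>.\<close>
  define var where "var = (\<lambda>\<nu> (\<alpha> :: nat \<Rightarrow> real). \<Sum>j=1..\<nu>. \<bar>g (\<alpha> j) - g (\<alpha> (j - 1))\<bar>)"
  define A where "A = (\<lambda>x. {var \<nu> \<alpha> |\<nu> \<alpha>. is_division a x \<nu> \<alpha>})"
  obtain M where M: "\<And>\<nu> \<alpha>. is_division a b \<nu> \<alpha> \<Longrightarrow> var \<nu> \<alpha> \<le> M"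
    using assms by (auto simp: has_bounded_variation_def var_def)
  \<comment> \<open>Appending \<open>y\<close> to a division of \<open>[a, x]\<close> adds exactly
    the increment in question. This gives the inequality for the suprema, and with
    \<open>y = b\<close> it bounds every \<open>A x\<close> by \<open>M\<close>.\<close>
  have extend: "is_division a y (Suc \<nu>) (\<alpha>(Suc \<nu> := y))"
      "var (Suc \<nu>) (\<alpha>(Suc \<nu> := y)) = var \<nu> \<alpha> + \<bar>g y - g x\<bar>"
    if "is_division a x \<nu> \<alpha>" "x < y" for x y \<nu> \<alpha>
  proof -
    have "(\<Sum>j=1..\<nu>. \<bar>g ((\<alpha>(Suc \<nu> := y)) j) - g ((\<alpha>(Suc \<nu> := y)) (j - 1))\<bar>) = var \<nu> \<alpha>"
      unfolding var_def by (intro sum.cong) auto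
    then show "var (Suc \<nu>) (\<alpha>(Suc \<nu> := y)) = var \<nu> \<alpha> + \<bar>g y - g x\<bar>"
      using that by (simp add: var_def is_division_def)
    show "is_division a y (Suc \<nu>) (\<alpha>(Suc \<nu> := y))"
      using that by (auto simp: is_division_def le_Suc_eq)
  qed
  have bdd: "bdd_above (A x)" if "x \<le> b" for x
  proof (intro bdd_aboveI[of _ M])
    fix v assume "v \<in> A x"
    then obtain \<nu> \<alpha> where v: "v = var \<nu> \<alpha>" "is_division a x \<nu> \<alpha>"
      by (auto simp: A_def)
    show "v \<le> M"
    proof (cases "x = b")
      case False
      with that have "x < b" by simp
      from extend[OF v(2) this] M[OF extend(1)[OF v(2) this]] v(1) show ?thesis
        by linarith
    qed (use v M in auto)
  qed
  have ne: "A x \<noteq> {}" if "a \<le> x" for x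
  proof (cases "a = x")
    case True
    then have "is_division a x 0 (\<lambda>_. a)"
      by (simp add: is_division_def)
    then show ?thesis by (auto simp: A_def)
  next
    case False
    then have "is_division a x 1 (\<lambda>j. if j = 0 then a else x)"
      using that by (simp add: is_division_def)
    then show ?thesis by (auto simp: A_def)
  qed
  show ?thesis
  proof (rule that[of "\<lambda>x. Sup (A x)"])
    fix x y assume xy: "a \<le> x" "x \<le> y" "y \<le> b"
    show "\<bar>g y - g x\<bar> \<le> Sup (A y) - Sup (A x)"
    proof (cases "x = y")
      case False
      with xy have "x < y" by simp
      have "Sup (A x) \<le> Sup (A y) - \<bar>g y - g x\<bar>"
      proof (rule cSup_least[OF ne[OF xy(1)]])
        fix v assume "v \<in> A x"
        then obtain \<nu> \<alpha> where v: "v = var \<nu> \<alpha>" "is_division a x \<nu> \<alpha>"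
          by (auto simp: A_def)
        have "v + \<bar>g y - g x\<bar> \<in> A y"
          using extend[OF v(2) \<open>x < y\<close>] v(1) unfolding A_def
          by (metis (mono_tags, lifting) mem_Collect_eq)
        then have "v + \<bar>g y - g x\<bar> \<le> Sup (A y)"
          by (rule cSup_upper[OF _ bdd[OF xy(3)]])
        then show "v \<le> Sup (A y) - \<bar>g y - g x\<bar>"
          by simp
      qed
      then show ?thesis by simp
    qed simp
  qed
qed

text \<open>The increments of \<open>g\<close> are dominated by those of \<open>V\<close>, which
  telescope, so the bound does not depend on the partition.\<close>

lemma stieltjes_sum_bound_integrand:
  assumes p: "is_partition a b \<nu> \<alpha> \<xi>"
    and V: "\<And>x y. a \<le> x \<Longrightarrow> x \<le> y \<Longrightarrow> y \<le> b \<Longrightarrow> \<bar>g y - g x\<bar> \<le> V y - V x"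
    and r: "\<And>t. t \<in> {a..b} \<Longrightarrow> \<bar>r t\<bar> \<le> e"
  shows "\<bar>stieltjes_sum r g \<nu> \<alpha> \<xi>\<bar> \<le> e * (V b - V a)"
proof -
  have "\<bar>stieltjes_sum r g \<nu> \<alpha> \<xi>\<bar> \<le> (\<Sum>j=1..\<nu>. e * (V (\<alpha> j) - V (\<alpha> (j - 1))))"
    unfolding stieltjes_sum_def
  proof (rule order_trans[OF sum_abs sum_mono])
    fix j assume j: "j \<in> {1..\<nu>}"
    have "\<alpha> (j - 1) \<in> {a..b}" "\<alpha> j \<in> {a..b}" "\<alpha> (j - 1) \<le> \<alpha> j"
      using j division_mem[OF partition_division[OF p]]
        division_le[OF partition_division[OF p], of "j - 1" j] by auto
    then show "\<bar>r (\<xi> j) * (g (\<alpha> j) - g (\<alpha> (j - 1)))\<bar> \<le> e * (V (\<alpha> j) - V (\<alpha> (j - 1)))"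
      unfolding abs_mult using V[of "\<alpha> (j - 1)" "\<alpha> j"] r[OF partition_tag_mem[OF p j]]
      by (intro mult_mono) auto
  qed
  also have "\<dots> = e * (V (\<alpha> \<nu>) - V (\<alpha> 0))"
    by (simp add: sum_distrib_left[symmetric] sum_telescope_from_1[where h = "\<lambda>j. V (\<alpha> j)", simplified])
  also have "\<dots> = e * (V b - V a)"
    using p by (simp add: is_partition_def is_division_def)
  finally show ?thesis .
qed

text \<open>Summation by parts turns the sum into one with integrator \<^term>\<open>g\<close>, in which tags and
  division points exchange their roles.\<close>

lemma stieltjes_sum_bound_integrator:
  assumes "a < b" and p: "is_partition a b \<nu> \<alpha> \<xi>"
    and V: "\<And>x y. a \<le> x \<Longrightarrow> x \<le> y \<Longrightarrow> y \<le> b \<Longrightarrow> \<bar>g y - g x\<bar> \<le> V y - V x"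
    and r: "\<And>t. t \<in> {a..b} \<Longrightarrow> \<bar>r t\<bar> \<le> e"
  shows "\<bar>stieltjes_sum g r \<nu> \<alpha> \<xi>\<bar> \<le> e * (2 * \<bar>g a\<bar> + 3 * (V b - V a))"
proof -
  note d = partition_division[OF p]
  have \<nu>: "1 \<le> \<nu>"
    by (rule division_length_pos[OF d \<open>a < b\<close>])
  have e: "0 \<le> e"
    using r[of a] \<open>a < b\<close> by simp
  \<comment> \<open>Up to sign, the quantity inside the absolute value is the sum of
    \<open>(g (\<xi> (Suc k)) - g (\<xi> k)) * r (\<alpha> k)\<close> over \<open>k\<close> from 1
    to \<open>n - 1\<close>. The induction starts at 1 because the first tag enters the boundary
    term.\<close>
  have part: "\<bar>stieltjes_sum g r n \<alpha> \<xi> - g (\<xi> n) * r (\<alpha> n) + g (\<xi> 1) * r (\<alpha> 0)\<bar>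
      \<le> e * (V (\<xi> n) - V (\<xi> 1))" if "1 \<le> n" "n \<le> \<nu>" for n
    using that
  proof (induction n rule: nat_induct_at_least)
    case base
    then show ?case by (simp add: stieltjes_sum_def algebra_simps)
  next
    case (Suc n)
    have "\<bar>(g (\<xi> (Suc n)) - g (\<xi> n)) * r (\<alpha> n)\<bar> \<le> (V (\<xi> (Suc n)) - V (\<xi> n)) * e"
      unfolding abs_mult
    proof (intro mult_mono V r)
      show "\<xi> n \<le> \<xi> (Suc n)" "a \<le> \<xi> n" "\<xi> (Suc n) \<le> b" "\<alpha> n \<in> {a..b}"
        using Suc partition_tag_mono[OF p, of n "Suc n"] partition_tag_mem[OF p, of n]
          partition_tag_mem[OF p, of "Suc n"] division_mem[OF d, of n] by auto
      then show "0 \<le> V (\<xi> (Suc n)) - V (\<xi> n)"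
        using V[of "\<xi> n" "\<xi> (Suc n)"] by linarith
    qed simp
    moreover have "stieltjes_sum g r (Suc n) \<alpha> \<xi> - g (\<xi> (Suc n)) * r (\<alpha> (Suc n)) + g (\<xi> 1) * r (\<alpha> 0)
      = (stieltjes_sum g r n \<alpha> \<xi> - g (\<xi> n) * r (\<alpha> n) + g (\<xi> 1) * r (\<alpha> 0))
        - (g (\<xi> (Suc n)) - g (\<xi> n)) * r (\<alpha> n)"
      by (simp add: stieltjes_sum_def algebra_simps)
    moreover have "\<bar>stieltjes_sum g r n \<alpha> \<xi> - g (\<xi> n) * r (\<alpha> n) + g (\<xi> 1) * r (\<alpha> 0)\<bar>
      \<le> e * (V (\<xi> n) - V (\<xi> 1))"
      using Suc by simp
    ultimately show ?case
      by (simp add: algebra_simps)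
  qed
  have tags: "\<xi> 1 \<in> {a..b}" "\<xi> \<nu> \<in> {a..b}"
    using partition_tag_mem[OF p] \<nu> by auto
  \<comment> \<open>On \<open>[a, b]\<close> the function \<open>g\<close> is bounded by
    \<open>\<bar>g a\<bar> + (V b - V a)\<close>. Two boundary terms of this size and one full
    increment of \<open>V\<close> produce the coefficients 2 and 3.\<close>
  have bound: "\<bar>g t * r u\<bar> \<le> (\<bar>g a\<bar> + (V b - V a)) * e" if "t \<in> {a..b}" "u \<in> {a..b}" for t u
    unfolding abs_mult
    using that V[of a t] V[of t b] V[of a b] r[OF that(2)] e by (intro mult_mono) auto
  have "\<bar>g (\<xi> \<nu>) * r (\<alpha> \<nu>)\<bar> \<le> (\<bar>g a\<bar> + (V b - V a)) * e"
    "\<bar>g (\<xi> 1) * r (\<alpha> 0)\<bar> \<le> (\<bar>g a\<bar> + (V b - V a)) * e"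
    using tags division_mem[OF d] by (auto intro!: bound)
  moreover have "e * (V (\<xi> \<nu>) - V (\<xi> 1)) \<le> e * (V b - V a)"
    using tags V[of "\<xi> \<nu>" b] V[of a "\<xi> 1"] e by (intro mult_left_mono) auto
  ultimately have "\<bar>stieltjes_sum g r \<nu> \<alpha> \<xi>\<bar>
      \<le> e * (V b - V a) + (\<bar>g a\<bar> + (V b - V a)) * e + (\<bar>g a\<bar> + (V b - V a)) * e"
    using part[OF \<nu> order_refl] by linarith
  then show ?thesis
    by (simp add: algebra_simps)
qed

section \<open>Complementary pairs\<close>

text \<open>Completeness for a proper filter: approximating constants for tolerances
  \<open>1 / (n + 1)\<close> form a Cauchy sequence, since any two of the eventual estimates hold at
  a common point.\<close>

lemma convergent_if_approximable:
  fixes X :: "'p \<Rightarrow> real"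
  assumes "F \<noteq> bot" and "\<And>e. e > 0 \<Longrightarrow> \<exists>l. \<forall>\<^sub>F p in F. \<bar>X p - l\<bar> \<le> e"
  shows "\<exists>L. (X \<longlongrightarrow> L) F"
proof -
  have "\<exists>l. \<forall>\<^sub>F p in F. \<bar>X p - l\<bar> \<le> inverse (Suc n)" for n
    by (rule assms(2)) simp
  then obtain l where l: "\<And>n. \<forall>\<^sub>F p in F. \<bar>X p - l n\<bar> \<le> inverse (Suc n)"
    by metis
  have dist: "\<bar>l m - l n\<bar> \<le> inverse (Suc m) + inverse (Suc n)" for m n
  proof -
    have "\<exists>p. \<bar>X p - l m\<bar> \<le> inverse (Suc m) \<and> \<bar>X p - l n\<bar> \<le> inverse (Suc n)"
      using eventually_conj[OF l l] assms(1) by (rule eventually_happens'[rotated])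
    then show ?thesis by fastforce
  qed
  have "Cauchy l"
  proof (rule metric_CauchyI)
    fix e :: real assume "e > 0"
    then obtain N where N: "inverse (Suc N) < e / 2"
      using reals_Archimedean[of "e / 2"] by auto
    have "dist (l m) (l n) < e" if "m \<ge> N" "n \<ge> N" for m n
    proof -
      have "inverse (Suc m) \<le> inverse (real (Suc N))" "inverse (Suc n) \<le> inverse (real (Suc N))"
        using that by (auto intro!: le_imp_inverse_le)
      with dist[of m n] N show ?thesis
        unfolding dist_real_def by linarith
    qed
    then show "\<exists>N. \<forall>m\<ge>N. \<forall>n\<ge>N. dist (l m) (l n) < e"
      by blast
  qed
  then obtain L where L: "l \<longlonglongrightarrow> L"
    using Cauchy_convergent convergent_def by blast
  have "(X \<longlongrightarrow> L) F"
  proof (rule tendstoI)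
    fix e :: real assume "e > 0"
    have "\<forall>\<^sub>F n in sequentially. \<bar>l n - L\<bar> < e / 2 \<and> inverse (real (Suc n)) < e / 2"
      using tendstoD[OF L, of "e / 2"] tendstoD[OF LIMSEQ_inverse_real_of_nat, of "e / 2"] \<open>e > 0\<close>
      by (intro eventually_conj) (simp_all add: dist_real_def)
    then obtain n where n: "\<bar>l n - L\<bar> < e / 2" "inverse (real (Suc n)) < e / 2"
      by (auto dest: eventually_happens)
    show "\<forall>\<^sub>F p in F. dist (X p) L < e"
      using l[of n] by eventually_elim (use n in \<open>unfold dist_real_def, linarith\<close>)
  qed
  then show ?thesis by blast
qed

text \<open>The approximants \<open>d\<close> depend on \<open>e\<close> and are not known to
  converge. Hence both limits are obtained separately, and only their sum is compared with
  \<open>c\<close>, where \<open>d\<close> cancels and three errors add up.\<close>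

lemma complementary_limits:
  fixes X :: "'p \<Rightarrow> real" and Y :: "'q \<Rightarrow> real"
  assumes "F \<noteq> bot" "G \<noteq> bot"
    and approx: "\<And>e. e > 0 \<Longrightarrow> \<exists>c' d. \<bar>c' - c\<bar> \<le> e \<and>
      (\<forall>\<^sub>F p in F. \<bar>X p - (c' - d)\<bar> \<le> e) \<and> (\<forall>\<^sub>F q in G. \<bar>Y q - d\<bar> \<le> e)"
  shows "\<exists>d. (X \<longlongrightarrow> c - d) F \<and> (Y \<longlongrightarrow> d) G"
proof -
  obtain x where x: "(X \<longlongrightarrow> x) F"
    using convergent_if_approximable[OF assms(1), of X] approx by meson
  obtain y where y: "(Y \<longlongrightarrow> y) G"
    using convergent_if_approximable[OF assms(2), of Y] approx by meson
  have limit: "\<bar>z - l\<bar> \<le> e"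
    if "(Z \<longlongrightarrow> z) H" "H \<noteq> bot" "\<forall>\<^sub>F p in H. \<bar>Z p - l\<bar> \<le> e"
    for Z :: "'r \<Rightarrow> real" and z l e H
    using that(1) by (intro tendsto_upperbound[OF _ that(3,2)] tendsto_intros)
  have "\<bar>x + y - c\<bar> \<le> e" if "e > 0" for e
  proof -
    obtain c' d where "\<bar>c' - c\<bar> \<le> e / 3" and
      ev: "\<forall>\<^sub>F p in F. \<bar>X p - (c' - d)\<bar> \<le> e / 3" "\<forall>\<^sub>F q in G. \<bar>Y q - d\<bar> \<le> e / 3"
      using approx[of "e / 3"] \<open>e > 0\<close> by auto
    moreover have "\<bar>x - (c' - d)\<bar> \<le> e / 3" "\<bar>y - d\<bar> \<le> e / 3"
      using limit[OF x assms(1) ev(1)] limit[OF y assms(2) ev(2)] by auto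
    ultimately show ?thesis by linarith
  qed
  then have "\<bar>x + y - c\<bar> \<le> 0"
    by (rule field_le_epsilon[of _ 0, simplified])
  then have "x = c - y" by simp
  with x y show ?thesis by blast
qed

text \<open>Existence of both integrals together with integration by parts; \<open>d\<close> is the
  Dushnik integral of \<open>g\<close> against \<open>f\<close>. The two functions enter
  asymmetrically, so later facts come in two orders.\<close>

definition parts_pair :: "real \<Rightarrow> real \<Rightarrow> (real \<Rightarrow> real) \<Rightarrow> (real \<Rightarrow> real) \<Rightarrow> bool" where
  "parts_pair a b f g \<longleftrightarrow> (\<exists>d. (stieltjes f g \<longlongrightarrow> f b * g b - f a * g a - d) (ks_filter a b) \<and>
     (stieltjes g f \<longlongrightarrow> d) (dushnik_filter a b))"

lemma parts_pair_add_left: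
  assumes "parts_pair a b f g" "parts_pair a b f' g"
  shows "parts_pair a b (\<lambda>t. f t + f' t) g"
proof -
  obtain d where d: "(stieltjes f g \<longlongrightarrow> f b * g b - f a * g a - d) (ks_filter a b)"
    "(stieltjes g f \<longlongrightarrow> d) (dushnik_filter a b)"
    using assms(1) by (auto simp: parts_pair_def)
  obtain d' where d': "(stieltjes f' g \<longlongrightarrow> f' b * g b - f' a * g a - d') (ks_filter a b)"
    "(stieltjes g f' \<longlongrightarrow> d') (dushnik_filter a b)"
    using assms(2) by (auto simp: parts_pair_def)
  show ?thesis
    unfolding parts_pair_def
    using tendsto_add[OF d(1) d'(1)] tendsto_add[OF d(2) d'(2)]
    by (intro exI[of _ "d + d'"]) (simp add: stieltjes_add_left stieltjes_add_right algebra_simps)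
qed

lemma parts_pair_add_right:
  assumes "parts_pair a b f g" "parts_pair a b f g'"
  shows "parts_pair a b f (\<lambda>t. g t + g' t)"
proof -
  obtain d where d: "(stieltjes f g \<longlongrightarrow> f b * g b - f a * g a - d) (ks_filter a b)"
    "(stieltjes g f \<longlongrightarrow> d) (dushnik_filter a b)"
    using assms(1) by (auto simp: parts_pair_def)
  obtain d' where d': "(stieltjes f g' \<longlongrightarrow> f b * g' b - f a * g' a - d') (ks_filter a b)"
    "(stieltjes g' f \<longlongrightarrow> d') (dushnik_filter a b)"
    using assms(2) by (auto simp: parts_pair_def)
  show ?thesis
    unfolding parts_pair_def
    using tendsto_add[OF d(1) d'(1)] tendsto_add[OF d(2) d'(2)]
    by (intro exI[of _ "d + d'"]) (simp add: stieltjes_add_left stieltjes_add_right algebra_simps)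
qed

lemma parts_pair_cmult:
  assumes "parts_pair a b f g"
  shows "parts_pair a b (\<lambda>t. k * f t) g" "parts_pair a b f (\<lambda>t. k * g t)"
proof -
  obtain d where d: "(stieltjes f g \<longlongrightarrow> f b * g b - f a * g a - d) (ks_filter a b)"
    "(stieltjes g f \<longlongrightarrow> d) (dushnik_filter a b)"
    using assms by (auto simp: parts_pair_def)
  show "parts_pair a b (\<lambda>t. k * f t) g" "parts_pair a b f (\<lambda>t. k * g t)"
    unfolding parts_pair_def
    using tendsto_mult_left[OF d(1), of k] tendsto_mult_left[OF d(2), of k]
    by (auto intro!: exI[of _ "k * d"] simp: stieltjes_cmult_left stieltjes_cmult_right algebra_simps)
qed

lemma eventually_is_partition:
  "\<forall>\<^sub>F (\<nu>, \<alpha>, \<xi>) in ks_filter a b. is_partition a b \<nu> \<alpha> \<xi>"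
  "\<forall>\<^sub>F (\<nu>, \<alpha>, \<xi>) in dushnik_filter a b. is_partition a b \<nu> \<alpha> \<xi>"
  unfolding eventually_ks_filter eventually_dushnik_filter
  by (auto simp: fine_partition_def interior_partition_def gauge_on_def
      intro!: exI[of _ "\<lambda>_. 1 / 2"])

text \<open>Replacing \<open>f\<close> by a uniformly close \<open>s\<close> changes the sums in
  both positions, for every partition, and the boundary term by at most a fixed multiple of the
  distance. Complementary limits for \<open>s\<close> thus become approximate ones for
  \<open>f\<close>.\<close>

lemma parts_pair_uniform_limit:
  assumes "a < b" and bv: "has_bounded_variation a b g"
    and approx: "\<And>e. e > 0 \<Longrightarrow> \<exists>s. parts_pair a b s g \<and> parts_pair a b g s \<and> (\<forall>t\<in>{a..b}. \<bar>f t - s t\<bar> \<le> e)"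
  shows "parts_pair a b f g" "parts_pair a b g f"
proof -
  obtain V where V: "\<And>x y. a \<le> x \<Longrightarrow> x \<le> y \<Longrightarrow> y \<le> b \<Longrightarrow> \<bar>g y - g x\<bar> \<le> V y - V x"
    using bounded_variation_majorant[OF bv] by blast
  \<comment> \<open>Dominates the constants of both sum bounds and of the boundary term,
    \<open>\<bar>g a\<bar> + \<bar>g b\<bar>\<close>.\<close>
  define K where "K = 2 * \<bar>g a\<bar> + \<bar>g b\<bar> + 3 * (V b - V a)"
  have V0: "0 \<le> V b - V a"
    using V[of a b] \<open>a < b\<close> by simp
  then have K: "0 \<le> K"
    by (simp add: K_def)
  note nonbot = ks_filter_nonbot[OF less_imp_le[OF \<open>a < b\<close>]] dushnik_filter_nonbot[OF \<open>a < b\<close>]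
  \<comment> \<open>Here \<open>d\<close> and \<open>d'\<close> are the Dushnik integrals of
    \<open>g\<close> against \<open>s\<close> and of \<open>s\<close> against \<open>g\<close>; the
    boundary term is common to both orders.\<close>
  have main: "\<exists>s d d'. 
      (\<bar>(s b * g b - s a * g a) - (f b * g b - f a * g a)\<bar> \<le> e \<and>
       (\<forall>\<^sub>F P in ks_filter a b. \<bar>stieltjes f g P - ((s b * g b - s a * g a) - d)\<bar> \<le> e) \<and>
       (\<forall>\<^sub>F P in dushnik_filter a b. \<bar>stieltjes g f P - d\<bar> \<le> e)) \<and>
       (\<forall>\<^sub>F P in ks_filter a b. \<bar>stieltjes g f P - ((s b * g b - s a * g a) - d')\<bar> \<le> e) \<and>
       (\<forall>\<^sub>F P in dushnik_filter a b. \<bar>stieltjes f g P - d'\<bar> \<le> e)"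
    if "e > 0" for e
  proof -
    \<comment> \<open>The factor 2 leaves half of \<open>e\<close> for the convergence of the sums
      of \<open>s\<close>; \<open>K + 1\<close> avoids division by zero.\<close>
    define e' where "e' = e / (2 * (K + 1))"
    have e': "e' > 0" "e' * K \<le> e / 2"
      using \<open>e > 0\<close> K by (auto simp: e'_def field_simps)
    obtain s where s: "parts_pair a b s g" "parts_pair a b g s"
      and close: "\<And>t. t \<in> {a..b} \<Longrightarrow> \<bar>f t - s t\<bar> \<le> e'"
      using approx[OF e'(1)] by blast
    have le: "e' * x \<le> e / 2" if "x \<le> K" for x
      using mult_left_mono[OF that, of e'] e' by linarith
    have split: "stieltjes f g P = stieltjes s g P + stieltjes (\<lambda>t. f t - s t) g P"
      "stieltjes g f P = stieltjes g s P + stieltjes g (\<lambda>t. f t - s t) P" for P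
      using fun_cong[OF stieltjes_add_left[of s "\<lambda>t. f t - s t" g], of P]
        fun_cong[OF stieltjes_add_right[of g s "\<lambda>t. f t - s t"], of P]
      by simp_all
    have near: "\<bar>stieltjes f g P - stieltjes s g P\<bar> \<le> e / 2 \<and> \<bar>stieltjes g f P - stieltjes g s P\<bar> \<le> e / 2"
      if "case P of (\<nu>, \<alpha>, \<xi>) \<Rightarrow> is_partition a b \<nu> \<alpha> \<xi>" for P
    proof (cases P)
      case (fields \<nu> \<alpha> \<xi>)
      with that have p: "is_partition a b \<nu> \<alpha> \<xi>" by simp
      have "\<bar>stieltjes (\<lambda>t. f t - s t) g P\<bar> \<le> e' * (V b - V a)"
        using stieltjes_sum_bound_integrand[OF p V close] by (simp add: stieltjes_def fields)
      moreover have "\<bar>stieltjes g (\<lambda>t. f t - s t) P\<bar> \<le> e' * (2 * \<bar>g a\<bar> + 3 * (V b - V a))"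
        using stieltjes_sum_bound_integrator[OF \<open>a < b\<close> p V close] by (simp add: stieltjes_def fields)
      moreover have "e' * (V b - V a) \<le> e / 2" "e' * (2 * \<bar>g a\<bar> + 3 * (V b - V a)) \<le> e / 2"
        by (rule le, use V0 in \<open>simp add: K_def\<close>)+
      ultimately show ?thesis
        using split by simp
    qed
    have transfer: "\<forall>\<^sub>F P in F. \<bar>X P - l\<bar> \<le> e"
      if lim: "(Y \<longlongrightarrow> l) F" and XY: "\<forall>\<^sub>F P in F. \<bar>X P - Y P\<bar> \<le> e / 2"
      for X Y :: "nat \<times> (nat \<Rightarrow> real) \<times> (nat \<Rightarrow> real) \<Rightarrow> real" and l F
    proof -
      have "\<forall>\<^sub>F P in F. \<bar>Y P - l\<bar> < e / 2"
        using tendstoD[OF lim, of "e / 2"] \<open>e > 0\<close> by (simp add: dist_real_def)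
      then show ?thesis
        using XY by eventually_elim linarith
    qed
    have evK: "\<forall>\<^sub>F P in ks_filter a b. \<bar>stieltjes f g P - stieltjes s g P\<bar> \<le> e / 2"
      "\<forall>\<^sub>F P in ks_filter a b. \<bar>stieltjes g f P - stieltjes g s P\<bar> \<le> e / 2"
      using eventually_is_partition(1) by (rule eventually_mono; use near in blast)+
    have evD: "\<forall>\<^sub>F P in dushnik_filter a b. \<bar>stieltjes f g P - stieltjes s g P\<bar> \<le> e / 2"
      "\<forall>\<^sub>F P in dushnik_filter a b. \<bar>stieltjes g f P - stieltjes g s P\<bar> \<le> e / 2"
      using eventually_is_partition(2) by (rule eventually_mono; use near in blast)+
    obtain d where d: "(stieltjes s g \<longlongrightarrow> s b * g b - s a * g a - d) (ks_filter a b)"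
      "(stieltjes g s \<longlongrightarrow> d) (dushnik_filter a b)"
      using s(1) by (auto simp: parts_pair_def)
    obtain d' where d': "(stieltjes g s \<longlongrightarrow> s b * g b - s a * g a - d') (ks_filter a b)"
      "(stieltjes s g \<longlongrightarrow> d') (dushnik_filter a b)"
      using s(2) by (auto simp: parts_pair_def mult.commute)
    have "\<bar>(s b - f b) * g b\<bar> \<le> e' * \<bar>g b\<bar>" "\<bar>(s a - f a) * g a\<bar> \<le> e' * \<bar>g a\<bar>"
      unfolding abs_mult using close[of a] close[of b] \<open>a < b\<close>
      by (auto intro!: mult_right_mono simp: abs_minus_commute)
    moreover have "e' * (\<bar>g b\<bar> + \<bar>g a\<bar>) \<le> e / 2"
      by (rule le) (use V0 in \<open>simp add: K_def\<close>)
    ultimately have "\<bar>(s b * g b - s a * g a) - (f b * g b - f a * g a)\<bar> \<le> e"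
      using \<open>e > 0\<close> by (simp add: algebra_simps abs_le_iff)
    with transfer[OF d(1) evK(1)] transfer[OF d(2) evD(2)] transfer[OF d'(1) evK(2)]
      transfer[OF d'(2) evD(1)]
    show ?thesis by blast
  qed
  show "parts_pair a b f g"
    unfolding parts_pair_def using main by (intro complementary_limits[OF nonbot]) blast
  have "\<exists>d. (stieltjes g f \<longlongrightarrow> (f b * g b - f a * g a) - d) (ks_filter a b) \<and>
      (stieltjes f g \<longlongrightarrow> d) (dushnik_filter a b)"
    using main by (intro complementary_limits[OF nonbot]) blast
  then show "parts_pair a b g f"
    by (simp add: parts_pair_def mult.commute)
qed

section \<open>One-sided limits\<close>

lemma left_lim_tendsto:
  assumes "regulated_on a b h" "t \<in> {a<..b}"
  shows "(h \<longlongrightarrow> left_lim h t) (at_left t)"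
proof -
  obtain l where l: "(h \<longlongrightarrow> l) (at_left t)"
    using assms unfolding regulated_on_def by blast
  then have "left_lim h t = l"
    unfolding left_lim_def by (intro tendsto_Lim) auto
  with l show ?thesis by simp
qed

lemma right_lim_tendsto:
  assumes "regulated_on a b h" "t \<in> {a..<b}"
  shows "(h \<longlongrightarrow> right_lim h t) (at_right t)"
proof -
  obtain l where l: "(h \<longlongrightarrow> l) (at_right t)"
    using assms unfolding regulated_on_def by blast
  then have "right_lim h t = l"
    unfolding right_lim_def by (intro tendsto_Lim) auto
  with l show ?thesis by simp
qed

section \<open>Indicators of rays\<close>

lemma tendsto_ks_filterI:
  assumes "\<And>e. e > 0 \<Longrightarrow> \<exists>\<delta>. gauge_on a b \<delta> \<and>
    (\<forall>\<nu> \<alpha> \<xi>. fine_partition a b \<delta> \<nu> \<alpha> \<xi> \<longrightarrow> \<bar>stieltjes_sum f g \<nu> \<alpha> \<xi> - l\<bar> < e)"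
  shows "(stieltjes f g \<longlongrightarrow> l) (ks_filter a b)"
proof (rule tendstoI)
  fix e :: real assume "e > 0"
  then have "\<forall>\<^sub>F (\<nu>, \<alpha>, \<xi>) in ks_filter a b. \<bar>stieltjes_sum f g \<nu> \<alpha> \<xi> - l\<bar> < e"
    unfolding eventually_ks_filter by (rule assms)
  then show "\<forall>\<^sub>F P in ks_filter a b. dist (stieltjes f g P) l < e"
    by eventually_elim (auto simp: stieltjes_def dist_real_def)
qed

lemma tendsto_dushnik_filterI:
  assumes "\<And>e. e > 0 \<Longrightarrow> \<exists>B. finite B \<and> B \<subseteq> {a..b} \<and>
    (\<forall>\<nu> \<alpha> \<xi>. interior_partition a b B \<nu> \<alpha> \<xi> \<longrightarrow> \<bar>stieltjes_sum f g \<nu> \<alpha> \<xi> - l\<bar> < e)"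
  shows "(stieltjes f g \<longlongrightarrow> l) (dushnik_filter a b)"
proof (rule tendstoI)
  fix e :: real assume "e > 0"
  then have "\<forall>\<^sub>F (\<nu>, \<alpha>, \<xi>) in dushnik_filter a b. \<bar>stieltjes_sum f g \<nu> \<alpha> \<xi> - l\<bar> < e"
    unfolding eventually_dushnik_filter by (rule assms)
  then show "\<forall>\<^sub>F P in dushnik_filter a b. dist (stieltjes f g P) l < e"
    by eventually_elim (auto simp: stieltjes_def dist_real_def)
qed

lemma parts_pair_const_on:
  assumes s: "\<And>t. t \<in> {a..b} \<Longrightarrow> s t = v" and "a \<le> b"
  shows "parts_pair a b s k" "parts_pair a b k s"
proof -
  have left: "stieltjes_sum s k \<nu> \<alpha> \<xi> = v * (k b - k a)" if "is_partition a b \<nu> \<alpha> \<xi>" for \<nu> \<alpha> \<xi>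
  proof -
    have "stieltjes_sum s k \<nu> \<alpha> \<xi> = (\<Sum>j=1..\<nu>. v * (k (\<alpha> j) - k (\<alpha> (j - 1))))"
      unfolding stieltjes_sum_def by (intro sum.cong refl) (simp only: s[OF partition_tag_mem[OF that]])
    also have "\<dots> = v * (k (\<alpha> \<nu>) - k (\<alpha> 0))"
      by (simp only: sum_distrib_left[symmetric] sum_telescope_from_1[where h = "\<lambda>j. k (\<alpha> j)"])
    finally show ?thesis
      using that by (simp add: is_partition_def is_division_def)
  qed
  have right: "stieltjes_sum k s \<nu> \<alpha> \<xi> = 0" if "is_partition a b \<nu> \<alpha> \<xi>" for \<nu> \<alpha> \<xi>
  proof -
    have "s (\<alpha> j) = v" if "j \<le> \<nu>" for j
      using s division_mem[OF partition_division[OF \<open>is_partition a b \<nu> \<alpha> \<xi>\<close>] that] by blast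
    then show ?thesis
      unfolding stieltjes_sum_def by (intro sum.neutral) auto
  qed
  have ks: "(stieltjes f g \<longlongrightarrow> l) (ks_filter a b)"
    and dushnik: "(stieltjes f g \<longlongrightarrow> l) (dushnik_filter a b)"
    if "\<And>\<nu> \<alpha> \<xi>. is_partition a b \<nu> \<alpha> \<xi> \<Longrightarrow> stieltjes_sum f g \<nu> \<alpha> \<xi> = l" for f g l
    by (intro tendsto_ks_filterI exI[of _ "\<lambda>_. 1 / 2"];
        use that in \<open>auto simp: gauge_on_def fine_partition_def\<close>)
      (intro tendsto_dushnik_filterI exI[of _ "{}"];
        use that in \<open>auto simp: interior_partition_def\<close>)
  have ends: "s a = v" "s b = v"
    using s \<open>a \<le> b\<close> by auto
  show "parts_pair a b s k"
    unfolding parts_pair_def ends using ks[OF left] dushnik[OF right]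
    by (intro exI[of _ 0]) (simp add: algebra_simps)
  show "parts_pair a b k s"
    unfolding parts_pair_def ends using dushnik[OF left] ks[OF right]
    by (intro exI[of _ "v * (k b - k a)"]) (simp add: algebra_simps)
qed

section \<open>Closed form of Stieltjes sums with a ray indicator\<close>

lemma ex_cut:
  fixes n :: nat
  assumes "\<And>i j. 1 \<le> i \<Longrightarrow> i \<le> j \<Longrightarrow> j \<le> n \<Longrightarrow> Q i \<Longrightarrow> Q j"
  shows "\<exists>m\<le>n. \<forall>j\<in>{1..n}. Q j \<longleftrightarrow> m < j"
  using assms
proof (induction n)
  case (Suc n)
  then obtain m where m: "m \<le> n" "\<forall>j\<in>{1..n}. Q j \<longleftrightarrow> m < j"
    by (metis le_SucI)
  show ?case
  proof (cases "Q (Suc n)")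
    case True
    with m show ?thesis
      by (intro exI[of _ m]) (auto simp: le_Suc_eq)
  next
    case False
    then have "\<not> Q j" if "j \<in> {1..Suc n}" for j
      using Suc.prems[of j "Suc n"] that by auto
    then show ?thesis
      by (intro exI[of _ "Suc n"]) auto
  qed
qed auto

lemma stieltjes_sum_cut:
  assumes "m \<le> \<nu>" "\<And>j. j \<in> {1..\<nu>} \<Longrightarrow> \<xi> j \<in> U \<longleftrightarrow> m < j"
  shows "stieltjes_sum (indicator U) k \<nu> \<alpha> \<xi> = k (\<alpha> \<nu>) - k (\<alpha> m)"
proof -
  have "stieltjes_sum (indicator U) k \<nu> \<alpha> \<xi> = (\<Sum>j\<in>{Suc m..\<nu>}. k (\<alpha> j) - k (\<alpha> (j - 1)))"
    unfolding stieltjes_sum_def using assms(2)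
    by (intro sum.mono_neutral_cong_right) (auto simp: indicator_def)
  also have "\<dots> = k (\<alpha> \<nu>) - k (\<alpha> m)"
    using sum_telescope''[OF assms(1), of "\<lambda>j. k (\<alpha> j)"] .
  finally show ?thesis .
qed

text \<open>The tags in the ray form a final segment and the increments of \<open>k\<close> over
  their cells telescope. Convergence thus depends only on the location of
  \<open>\<alpha> m\<close>.\<close>

lemma stieltjes_sum_indicator_integrand:
  assumes p: "is_partition a b \<nu> \<alpha> \<xi>" and U: "U = {c..} \<or> U = {c<..}"
  shows "\<exists>m\<le>\<nu>. (\<forall>j\<in>{1..\<nu>}. \<xi> j \<in> U \<longleftrightarrow> m < j) \<and>
    stieltjes_sum (indicator U) k \<nu> \<alpha> \<xi> = k b - k (\<alpha> m)"
proof -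
  have "\<exists>m\<le>\<nu>. \<forall>j\<in>{1..\<nu>}. \<xi> j \<in> U \<longleftrightarrow> m < j"
  proof (rule ex_cut)
    fix i j assume "1 \<le> i" "i \<le> j" "j \<le> \<nu>" "\<xi> i \<in> U"
    then show "\<xi> j \<in> U"
      using partition_tag_mono[OF p, of i j] U by auto
  qed
  then obtain m where m: "m \<le> \<nu>" "\<And>j. j \<in> {1..\<nu>} \<Longrightarrow> \<xi> j \<in> U \<longleftrightarrow> m < j"
    by blast
  have "\<alpha> \<nu> = b"
    using p by (simp add: is_partition_def is_division_def)
  with m stieltjes_sum_cut[OF m] show ?thesis
    by blast
qed

text \<open>The indicator changes over exactly one cell, the one in which the division enters the
  ray. Convergence thus depends only on the location of the tag of that cell.\<close>

lemma stieltjes_sum_indicator_integrator: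
  assumes p: "is_partition a b \<nu> \<alpha> \<xi>" and U: "U = {c..} \<or> U = {c<..}" and "a \<notin> U" "b \<in> U"
  shows "\<exists>m\<in>{1..\<nu>}. \<alpha> (m - 1) \<notin> U \<and> \<alpha> m \<in> U \<and> stieltjes_sum k (indicator U) \<nu> \<alpha> \<xi> = k (\<xi> m)"
proof -
  note d = partition_division[OF p]
  have ends: "\<alpha> 0 = a" "\<alpha> \<nu> = b"
    using d by (auto simp: is_division_def)
  have "\<exists>m\<le>\<nu>. \<forall>j\<in>{1..\<nu>}. \<alpha> j \<in> U \<longleftrightarrow> m < j"
  proof (rule ex_cut)
    fix i j assume "i \<le> j" "j \<le> \<nu>" "\<alpha> i \<in> U"
    then show "\<alpha> j \<in> U"
      using division_le[OF d, of i j] U by auto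
  qed
  then obtain m where m: "m \<le> \<nu>" "\<And>j. j \<in> {1..\<nu>} \<Longrightarrow> \<alpha> j \<in> U \<longleftrightarrow> m < j"
    by blast
  have cut: "\<alpha> j \<in> U \<longleftrightarrow> m < j" if "j \<le> \<nu>" for j
    using m(2)[of j] that ends(1) assms(3) by (cases j) auto
  have "m < \<nu>"
    using cut[of \<nu>] ends assms(4) by simp
  have "stieltjes_sum k (indicator U) \<nu> \<alpha> \<xi> = (\<Sum>j\<in>{1..\<nu>}. if j = Suc m then k (\<xi> (Suc m)) else 0)"
    unfolding stieltjes_sum_def
  proof (intro sum.cong refl)
    fix j assume "j \<in> {1..\<nu>}"
    then have "\<alpha> j \<in> U \<longleftrightarrow> m < j" "\<alpha> (j - 1) \<in> U \<longleftrightarrow> m < j - 1"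
      using cut by auto
    then show "k (\<xi> j) * (indicator U (\<alpha> j) - indicator U (\<alpha> (j - 1)))
        = (if j = Suc m then k (\<xi> (Suc m)) else 0)"
      by (auto simp: indicator_def)
  qed
  also have "\<dots> = k (\<xi> (Suc m))"
    using \<open>m < \<nu>\<close> by simp
  finally show ?thesis
    using cut[of m] cut[of "Suc m"] \<open>m < \<nu>\<close> by (intro bexI[of _ "Suc m"]) auto
qed

text \<open>Away from \<open>c\<close> the radius is at most half the distance to \<open>c\<close>,
  so no fine cell with such a tag reaches \<open>c\<close>: every cell containing \<open>c\<close>
  has tag \<open>c\<close> and stays within \<open>\<eta>\<close> of it. The bound
  \<open>1 / 2\<close> keeps the values below 1.\<close>

definition forcing_gauge :: "real \<Rightarrow> real \<Rightarrow> real \<Rightarrow> real" where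
  "forcing_gauge c \<eta> t = (if t = c then \<eta> else min (1 / 2) (\<bar>t - c\<bar> / 2))"

lemma gauge_on_forcing_gauge: "0 < \<eta> \<Longrightarrow> \<eta> < 1 \<Longrightarrow> gauge_on a b (forcing_gauge c \<eta>)"
  by (simp add: gauge_on_def forcing_gauge_def min_less_iff_disj)

lemma fine_partition_forced_tag:
  assumes "fine_partition a b (forcing_gauge c \<eta>) \<nu> \<alpha> \<xi>" "j \<in> {1..\<nu>}" "\<alpha> (j - 1) \<le> c" "c \<le> \<alpha> j"
  shows "\<xi> j = c" "c - \<eta> \<le> \<alpha> (j - 1)" "\<alpha> j \<le> c + \<eta>"
proof -
  have sub: "{\<alpha> (j - 1)..\<alpha> j} \<subseteq> {\<xi> j - forcing_gauge c \<eta> (\<xi> j)..\<xi> j + forcing_gauge c \<eta> (\<xi> j)}"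
    using assms by (auto simp: fine_partition_def)
  then have "c \<in> {\<xi> j - forcing_gauge c \<eta> (\<xi> j)..\<xi> j + forcing_gauge c \<eta> (\<xi> j)}"
    using assms(3,4) by auto
  then have near: "\<bar>\<xi> j - c\<bar> \<le> forcing_gauge c \<eta> (\<xi> j)"
    by (auto simp: abs_le_iff)
  show *: "\<xi> j = c"
  proof (rule ccontr)
    assume ne: "\<xi> j \<noteq> c"
    then have "forcing_gauge c \<eta> (\<xi> j) \<le> \<bar>\<xi> j - c\<bar> / 2"
      by (simp only: forcing_gauge_def if_False min.cobounded2)
    with near have "\<bar>\<xi> j - c\<bar> \<le> \<bar>\<xi> j - c\<bar> / 2"
      by (rule order_trans)
    with ne show False by simp
  qed
  show "c - \<eta> \<le> \<alpha> (j - 1)" "\<alpha> j \<le> c + \<eta>"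
    using sub assms(3,4) by (auto simp: * forcing_gauge_def)
qed

section \<open>Integrals with ray indicators in both modes\<close>

lemma dushnik_indicator_integrand:
  assumes U: "U = {c..} \<or> U = {c<..}" and c: "c \<in> {a..b}"
  shows "(stieltjes (indicator U) k \<longlongrightarrow> k b - k c) (dushnik_filter a b)"
proof (intro tendsto_dushnik_filterI exI[of _ "{c}"] conjI allI impI)
  fix e :: real and \<nu> \<alpha> \<xi> assume "e > 0" and i: "interior_partition a b {c} \<nu> \<alpha> \<xi>"
  then have d: "is_division a b \<nu> \<alpha>"
    by (auto simp: interior_partition_def is_partition_def)
  obtain m where m: "m \<le> \<nu>" "\<alpha> m = c"
    using i by (auto simp: interior_partition_def)
  \<comment> \<open>With \<open>c\<close> a division point and interior tags, no tag equals
    \<open>c\<close>, so closed and open rays give the same sums and the cut lies exactly at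
    \<open>c\<close>.\<close>
  have "\<xi> j \<in> U \<longleftrightarrow> m < j" if j: "j \<in> {1..\<nu>}" for j
  proof (cases "m < j")
    case True
    then have "c \<le> \<alpha> (j - 1)"
      using m j division_le[OF d, of m "j - 1"] by auto
    moreover have "\<alpha> (j - 1) < \<xi> j"
      using i j by (simp add: interior_partition_def)
    ultimately show ?thesis
      using True U by auto
  next
    case False
    then have "\<alpha> j \<le> c"
      using m division_le[OF d, of j m] by auto
    moreover have "\<xi> j < \<alpha> j"
      using i j by (simp add: interior_partition_def)
    ultimately show ?thesis
      using False U by auto
  qed
  from stieltjes_sum_cut[OF m(1) this] have "stieltjes_sum (indicator U) k \<nu> \<alpha> \<xi> = k b - k c"
    using m d by (simp add: is_division_def)
  then show "\<bar>stieltjes_sum (indicator U) k \<nu> \<alpha> \<xi> - (k b - k c)\<bar> < e"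
    using \<open>e > 0\<close> by simp
qed (use c in auto)

text \<open>The cell in which the division enters the ray contains \<open>c\<close>, so its tag is
  forced to be \<open>c\<close> and the sum equals \<open>k c\<close> exactly, for every
  \<open>e\<close>.\<close>

lemma ks_indicator_integrator:
  assumes U: "U = {c..} \<or> U = {c<..}" and "a \<notin> U" "b \<in> U"
  shows "(stieltjes k (indicator U) \<longlongrightarrow> k c) (ks_filter a b)"
proof (intro tendsto_ks_filterI exI[of _ "forcing_gauge c (1 / 2)"] conjI allI impI)
  fix e :: real and \<nu> \<alpha> \<xi> assume "e > 0" and f: "fine_partition a b (forcing_gauge c (1 / 2)) \<nu> \<alpha> \<xi>"
  then have p: "is_partition a b \<nu> \<alpha> \<xi>"
    by (simp add: fine_partition_def)
  obtain m where m: "m \<in> {1..\<nu>}" "\<alpha> (m - 1) \<notin> U" "\<alpha> m \<in> U"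
    "stieltjes_sum k (indicator U) \<nu> \<alpha> \<xi> = k (\<xi> m)"
    using stieltjes_sum_indicator_integrator[OF p U assms(2,3), of k] by blast
  then have "\<xi> m = c"
    using U by (intro fine_partition_forced_tag(1)[OF f]) auto
  with m \<open>e > 0\<close> show "\<bar>stieltjes_sum k (indicator U) \<nu> \<alpha> \<xi> - k c\<bar> < e"
    by simp
qed (simp add: gauge_on_forcing_gauge)

text \<open>With \<open>y < c\<close> and \<open>c\<close> both division points, the cell entering
  the ray ends at \<open>c\<close> and starts no earlier than \<open>y\<close>. Its interior tag
  lies strictly between, where \<open>k\<close> is close to its left limit.\<close>

lemma dushnik_closed_ray_integrator:
  assumes "a < c" "c \<le> b" and l: "(k \<longlongrightarrow> l) (at_left c)"
  shows "(stieltjes k (indicator {c..}) \<longlongrightarrow> l) (dushnik_filter a b)"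
proof (rule tendsto_dushnik_filterI)
  fix e :: real assume "e > 0"
  then obtain x where x: "x < c" "\<And>y. x < y \<Longrightarrow> y < c \<Longrightarrow> \<bar>k y - l\<bar> < e"
    using tendstoD[OF l \<open>e > 0\<close>] eventually_at_left[OF \<open>a < c\<close>] by (auto simp: dist_real_def)
  \<comment> \<open>The maximum with \<open>a\<close> keeps the prescribed division point inside
    \<open>[a, b]\<close>.\<close>
  define y where "y = max x a"
  have y: "a \<le> y" "x \<le> y" "y < c"
    using x(1) \<open>a < c\<close> by (auto simp: y_def)
  have "\<bar>stieltjes_sum k (indicator {c..}) \<nu> \<alpha> \<xi> - l\<bar> < e"
    if i: "interior_partition a b {y, c} \<nu> \<alpha> \<xi>" for \<nu> \<alpha> \<xi>
  proof -
    have p: "is_partition a b \<nu> \<alpha> \<xi>"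
      using i by (simp add: interior_partition_def)
    note d = partition_division[OF p]
    obtain m where m: "m \<in> {1..\<nu>}" "\<alpha> (m - 1) < c" "c \<le> \<alpha> m"
      "stieltjes_sum k (indicator {c..}) \<nu> \<alpha> \<xi> = k (\<xi> m)"
      using stieltjes_sum_indicator_integrator[OF p, of "{c..}" c k] assms(1,2) by force
    obtain u v where u: "u \<le> \<nu>" "\<alpha> u = y" and v: "v \<le> \<nu>" "\<alpha> v = c"
      using i by (force simp: interior_partition_def)
    have "\<not> m \<le> u"
      using division_le[OF d, of m u] u m y by auto
    then have "y \<le> \<alpha> (m - 1)"
      using division_le[OF d, of u "m - 1"] u m by auto
    moreover have "m - 1 \<le> \<nu>"
      using m(1) by auto
    then have "\<not> v \<le> m - 1"
      using division_le[OF d, of v "m - 1"] v m by auto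
    then have "\<alpha> m \<le> c"
      using division_le[OF d, of m v] v by auto
    moreover have "\<alpha> (m - 1) < \<xi> m" "\<xi> m < \<alpha> m"
      using i m(1) by (auto simp: interior_partition_def)
    ultimately show ?thesis
      using m(4) x(2)[of "\<xi> m"] y by simp
  qed
  then show "\<exists>B. finite B \<and> B \<subseteq> {a..b} \<and> (\<forall>\<nu> \<alpha> \<xi>. interior_partition a b B \<nu> \<alpha> \<xi> \<longrightarrow>
      \<bar>stieltjes_sum k (indicator {c..}) \<nu> \<alpha> \<xi> - l\<bar> < e)"
    using y assms by (intro exI[of _ "{y, c}"]) auto
qed

text \<open>Mirror image of the closed ray: the entering cell starts at \<open>c\<close> and ends no
  later than \<open>y\<close>, so its tag sees the right limit.\<close>

lemma dushnik_open_ray_integrator: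
  assumes "a \<le> c" "c < b" and l: "(k \<longlongrightarrow> l) (at_right c)"
  shows "(stieltjes k (indicator {c<..}) \<longlongrightarrow> l) (dushnik_filter a b)"
proof (rule tendsto_dushnik_filterI)
  fix e :: real assume "e > 0"
  then obtain x where x: "c < x" "\<And>y. c < y \<Longrightarrow> y < x \<Longrightarrow> \<bar>k y - l\<bar> < e"
    using tendstoD[OF l \<open>e > 0\<close>] eventually_at_right[OF \<open>c < b\<close>] by (auto simp: dist_real_def)
  define y where "y = min x b"
  have y: "y \<le> b" "y \<le> x" "c < y"
    using x(1) \<open>c < b\<close> by (auto simp: y_def)
  have "\<bar>stieltjes_sum k (indicator {c<..}) \<nu> \<alpha> \<xi> - l\<bar> < e"
    if i: "interior_partition a b {y, c} \<nu> \<alpha> \<xi>" for \<nu> \<alpha> \<xi>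
  proof -
    have p: "is_partition a b \<nu> \<alpha> \<xi>"
      using i by (simp add: interior_partition_def)
    note d = partition_division[OF p]
    obtain m where m: "m \<in> {1..\<nu>}" "\<alpha> (m - 1) \<le> c" "c < \<alpha> m"
      "stieltjes_sum k (indicator {c<..}) \<nu> \<alpha> \<xi> = k (\<xi> m)"
      using stieltjes_sum_indicator_integrator[OF p, of "{c<..}" c k] assms(1,2) by force
    obtain u v where u: "u \<le> \<nu>" "\<alpha> u = y" and v: "v \<le> \<nu>" "\<alpha> v = c"
      using i by (force simp: interior_partition_def)
    have "\<not> m \<le> v"
      using division_le[OF d, of m v] v m by auto
    then have "c \<le> \<alpha> (m - 1)"
      using division_le[OF d, of v "m - 1"] v m by auto
    moreover have "m - 1 \<le> \<nu>"
      using m(1) by auto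
    then have "\<not> u \<le> m - 1"
      using division_le[OF d, of u "m - 1"] u m y by auto
    then have "\<alpha> m \<le> y"
      using division_le[OF d, of m u] u by auto
    moreover have "\<alpha> (m - 1) < \<xi> m" "\<xi> m < \<alpha> m"
      using i m(1) by (auto simp: interior_partition_def)
    ultimately show ?thesis
      using m(4) x(2)[of "\<xi> m"] y by simp
  qed
  then show "\<exists>B. finite B \<and> B \<subseteq> {a..b} \<and> (\<forall>\<nu> \<alpha> \<xi>. interior_partition a b B \<nu> \<alpha> \<xi> \<longrightarrow>
      \<bar>stieltjes_sum k (indicator {c<..}) \<nu> \<alpha> \<xi> - l\<bar> < e)"
    using y assms by (intro exI[of _ "{y, c}"]) auto
qed

lemma ks_closed_ray_integrand:
  assumes "a < c" "c \<le> b" and l: "(k \<longlongrightarrow> l) (at_left c)"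
  shows "(stieltjes (indicator {c..}) k \<longlongrightarrow> k b - l) (ks_filter a b)"
proof (rule tendsto_ks_filterI)
  fix e :: real assume "e > 0"
  then obtain x where x: "x < c" "\<And>y. x < y \<Longrightarrow> y < c \<Longrightarrow> \<bar>k y - l\<bar> < e"
    using tendstoD[OF l \<open>e > 0\<close>] eventually_at_left[OF \<open>a < c\<close>] by (auto simp: dist_real_def)
  define \<eta> where "\<eta> = min (1 / 2) ((c - x) / 2)"
  have \<eta>: "0 < \<eta>" "\<eta> < 1" "x < c - \<eta>"
    using x(1) by (auto simp: \<eta>_def min_def field_simps)
  have "\<bar>stieltjes_sum (indicator {c..}) k \<nu> \<alpha> \<xi> - (k b - l)\<bar> < e"
    if f: "fine_partition a b (forcing_gauge c \<eta>) \<nu> \<alpha> \<xi>" for \<nu> \<alpha> \<xi>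
  proof -
    have p: "is_partition a b \<nu> \<alpha> \<xi>"
      using f by (simp add: fine_partition_def)
    have ends: "\<alpha> 0 = a" "\<alpha> \<nu> = b"
      using p by (auto simp: is_partition_def is_division_def)
    obtain m where m: "m \<le> \<nu>" "\<And>j. j \<in> {1..\<nu>} \<Longrightarrow> c \<le> \<xi> j \<longleftrightarrow> m < j"
      "stieltjes_sum (indicator {c..}) k \<nu> \<alpha> \<xi> = k b - k (\<alpha> m)"
      using stieltjes_sum_indicator_integrand[OF p, of "{c..}" c k] by auto
    \<comment> \<open>Otherwise cell \<open>m\<close>, whose tag lies before \<open>c\<close>, would
      contain \<open>c\<close> and have the forced tag \<open>c\<close>.\<close>
    have lt: "\<alpha> m < c"
    proof (cases "m = 0")
      case False
      then have mem: "m \<in> {1..\<nu>}" "\<xi> m < c"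
        using m(1) m(2)[of m] by auto
      show ?thesis
      proof (rule ccontr)
        assume "\<not> \<alpha> m < c"
        then have "\<xi> m = c"
          using mem partition_tag[OF p mem(1)]
          by (intro fine_partition_forced_tag(1)[OF f]) auto
        with mem show False by simp
      qed
    qed (use ends \<open>a < c\<close> in simp)
    then have "m < \<nu>"
      using m(1) ends \<open>c \<le> b\<close> by (cases "m = \<nu>") auto
    then have mem: "Suc m \<in> {1..\<nu>}" "c \<le> \<xi> (Suc m)"
      using m(2)[of "Suc m"] by auto
    \<comment> \<open>Cell \<open>Suc m\<close> starts before \<open>c\<close> and has a tag not
      before \<open>c\<close>, so it contains \<open>c\<close> and its left end is within
      \<open>\<eta>\<close> of \<open>c\<close>.\<close>
    then have "c - \<eta> \<le> \<alpha> m"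
      using fine_partition_forced_tag(2)[OF f mem(1)] partition_tag[OF p mem(1)] lt by simp
    then show ?thesis
      using m(3) x(2)[of "\<alpha> m"] lt \<eta> by simp
  qed
  then show "\<exists>\<delta>. gauge_on a b \<delta> \<and> (\<forall>\<nu> \<alpha> \<xi>. fine_partition a b \<delta> \<nu> \<alpha> \<xi> \<longrightarrow>
      \<bar>stieltjes_sum (indicator {c..}) k \<nu> \<alpha> \<xi> - (k b - l)\<bar> < e)"
    using gauge_on_forcing_gauge[OF \<eta>(1,2)] by blast
qed

lemma ks_open_ray_integrand:
  assumes "a \<le> c" "c < b" and l: "(k \<longlongrightarrow> l) (at_right c)"
  shows "(stieltjes (indicator {c<..}) k \<longlongrightarrow> k b - l) (ks_filter a b)"
proof (rule tendsto_ks_filterI)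
  fix e :: real assume "e > 0"
  then obtain x where x: "c < x" "\<And>y. c < y \<Longrightarrow> y < x \<Longrightarrow> \<bar>k y - l\<bar> < e"
    using tendstoD[OF l \<open>e > 0\<close>] eventually_at_right[OF \<open>c < b\<close>] by (auto simp: dist_real_def)
  define \<eta> where "\<eta> = min (1 / 2) ((x - c) / 2)"
  have \<eta>: "0 < \<eta>" "\<eta> < 1" "c + \<eta> < x"
    using x(1) by (auto simp: \<eta>_def min_def field_simps)
  have "\<bar>stieltjes_sum (indicator {c<..}) k \<nu> \<alpha> \<xi> - (k b - l)\<bar> < e"
    if f: "fine_partition a b (forcing_gauge c \<eta>) \<nu> \<alpha> \<xi>" for \<nu> \<alpha> \<xi>
  proof -
    have p: "is_partition a b \<nu> \<alpha> \<xi>"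
      using f by (simp add: fine_partition_def)
    have ends: "\<alpha> 0 = a" "\<alpha> \<nu> = b"
      using p by (auto simp: is_partition_def is_division_def)
    obtain m where m: "m \<le> \<nu>" "\<And>j. j \<in> {1..\<nu>} \<Longrightarrow> c < \<xi> j \<longleftrightarrow> m < j"
      "stieltjes_sum (indicator {c<..}) k \<nu> \<alpha> \<xi> = k b - k (\<alpha> m)"
      using stieltjes_sum_indicator_integrand[OF p, of "{c<..}" c k] by auto
    \<comment> \<open>Here the tag of cell \<open>Suc m\<close> exceeds \<open>c\<close>, so that
      cell cannot contain \<open>c\<close>; afterwards cell \<open>m\<close> is the one that
      contains \<open>c\<close>, which bounds its right end.\<close>
    have gt: "c < \<alpha> m"
    proof (cases "m = \<nu>")
      case False
      then have mem: "Suc m \<in> {1..\<nu>}" "c < \<xi> (Suc m)"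
        using m(1) m(2)[of "Suc m"] by auto
      show ?thesis
      proof (rule ccontr)
        assume "\<not> c < \<alpha> m"
        then have "\<xi> (Suc m) = c"
          using mem partition_tag[OF p mem(1)]
          by (intro fine_partition_forced_tag(1)[OF f]) auto
        with mem show False by simp
      qed
    qed (use ends \<open>c < b\<close> in simp)
    then have "0 < m"
      using ends \<open>a \<le> c\<close> by (cases m) auto
    then have mem: "m \<in> {1..\<nu>}" "\<xi> m \<le> c"
      using m(1) m(2)[of m] by auto
    then have "\<alpha> m \<le> c + \<eta>"
      using fine_partition_forced_tag(3)[OF f mem(1)] partition_tag[OF p mem(1)] gt by simp
    then show ?thesis
      using m(3) x(2)[of "\<alpha> m"] gt \<eta> by simp
  qed
  then show "\<exists>\<delta>. gauge_on a b \<delta> \<and> (\<forall>\<nu> \<alpha> \<xi>. fine_partition a b \<delta> \<nu> \<alpha> \<xi> \<longrightarrow>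
      \<bar>stieltjes_sum (indicator {c<..}) k \<nu> \<alpha> \<xi> - (k b - l)\<bar> < e)"
    using gauge_on_forcing_gauge[OF \<eta>(1,2)] by blast
qed

text \<open>For \<open>a < c\<close> the boundary term is \<open>k b\<close>. It splits as
  \<open>k b - l\<close> plus \<open>l\<close> in one order, with \<open>l\<close> the left limit at
  \<open>c\<close>, and as \<open>k c\<close> plus \<open>k b - k c\<close> in the other.\<close>

lemma parts_pair_closed_ray:
  assumes "a < b" "c \<in> {a..b}" "regulated_on a b k"
  shows "parts_pair a b (indicator {c..}) k" "parts_pair a b k (indicator {c..})"
proof -
  have "parts_pair a b (indicator {c..}) k \<and> parts_pair a b k (indicator {c..})"
  proof (cases "c = a")
    case True
    then show ?thesis
      using assms(1) by (intro conjI parts_pair_const_on[where v = 1]) auto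
  next
    case False
    then have c: "a < c" "c \<le> b" using assms(2) by auto
    then obtain l where l: "(k \<longlongrightarrow> l) (at_left c)"
      using left_lim_tendsto[OF assms(3)] by fastforce
    have "parts_pair a b (indicator {c..}) k"
      unfolding parts_pair_def
      using ks_closed_ray_integrand[OF c l] dushnik_closed_ray_integrator[OF c l] c
      by (intro exI[of _ l]) simp
    moreover have "parts_pair a b k (indicator {c..})"
      unfolding parts_pair_def
      using ks_indicator_integrator[of "{c..}" c a b k] dushnik_indicator_integrand[of "{c..}" c a b k] c
      by (intro exI[of _ "k b - k c"]) simp
    ultimately show ?thesis by blast
  qed
  then show "parts_pair a b (indicator {c..}) k" "parts_pair a b k (indicator {c..})"
    by auto
qed

lemma parts_pair_open_ray:
  assumes "a < b" "c \<in> {a..b}" "regulated_on a b k"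
  shows "parts_pair a b (indicator {c<..}) k" "parts_pair a b k (indicator {c<..})"
proof -
  have "parts_pair a b (indicator {c<..}) k \<and> parts_pair a b k (indicator {c<..})"
  proof (cases "c = b")
    case True
    then show ?thesis
      using assms(1) by (intro conjI parts_pair_const_on[where v = 0]) auto
  next
    case False
    then have c: "a \<le> c" "c < b" using assms(2) by auto
    then obtain l where l: "(k \<longlongrightarrow> l) (at_right c)"
      using right_lim_tendsto[OF assms(3)] by fastforce
    have "parts_pair a b (indicator {c<..}) k"
      unfolding parts_pair_def
      using ks_open_ray_integrand[OF c l] dushnik_open_ray_integrator[OF c l] c
      by (intro exI[of _ l]) simp
    moreover have "parts_pair a b k (indicator {c<..})"
      unfolding parts_pair_def
      using ks_indicator_integrator[of "{c<..}" c a b k] dushnik_indicator_integrand[of "{c<..}" c a b k] c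
      by (intro exI[of _ "k b - k c"]) simp
    ultimately show ?thesis by blast
  qed
  then show "parts_pair a b (indicator {c<..}) k" "parts_pair a b k (indicator {c<..})"
    by auto
qed

section \<open>Approximation by step functions\<close>

text \<open>The linear span of ray indicators: half-open intervals and single points are differences
  of rays. The inductive form makes membership in the pair relation a rule induction.\<close>

inductive step_function :: "real \<Rightarrow> real \<Rightarrow> (real \<Rightarrow> real) \<Rightarrow> bool" for a b where
  closed_ray: "c \<in> {a..b} \<Longrightarrow> step_function a b (indicator {c..})"
| open_ray: "c \<in> {a..b} \<Longrightarrow> step_function a b (indicator {c<..})"
| add: "step_function a b s \<Longrightarrow> step_function a b s' \<Longrightarrow> step_function a b (\<lambda>t. s t + s' t)"
| cmult: "step_function a b s \<Longrightarrow> step_function a b (\<lambda>t. k * s t)"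

lemma step_function_diff:
  assumes "step_function a b s" "step_function a b s'"
  shows "step_function a b (\<lambda>t. s t - s' t)"
  using step_function.add[OF assms(1) step_function.cmult[OF assms(2), of "-1"]] by simp

lemma step_function_parts_pair:
  assumes "step_function a b s" "a < b" "regulated_on a b k"
  shows "parts_pair a b s k" "parts_pair a b k s"
proof -
  have "parts_pair a b s k \<and> parts_pair a b k s"
    using assms
    by induction (auto intro: parts_pair_closed_ray parts_pair_open_ray parts_pair_add_left
        parts_pair_add_right parts_pair_cmult)
  then show "parts_pair a b s k" "parts_pair a b k s"
    by auto
qed

text \<open>Bisection again: near each point one constant on either side, together with the value at
  the point, is a good approximation, and approximants on adjacent intervals add up.\<close>

lemma regulated_step_approximation:
  assumes "a < b" and reg: "regulated_on a b f" and "e > 0"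
  shows "\<exists>s. step_function a b s \<and> (\<forall>t\<in>{a..b}. \<bar>f t - s t\<bar> \<le> e)"
proof -
  \<comment> \<open>Vanishing off the half-open interval makes adjacent approximants disjoint in
    support, so their sum is the concatenation. The point \<open>a\<close> is left out and restored
    at the end.\<close>
  define approx where "approx = (\<lambda>u v s. step_function a b s \<and> (\<forall>t\<in>{u<..v}. \<bar>f t - s t\<bar> \<le> e) \<and>
    (\<forall>t. t \<notin> {u<..v} \<longrightarrow> s t = 0))"
  have "a \<le> a \<and> b \<le> b \<longrightarrow> (\<exists>s. approx a b s)"
    using less_imp_le[OF \<open>a < b\<close>]
  \<comment> \<open>The guard confines the intervals to \<open>[a, b]\<close>, since the local
    condition ranges over all intervals around \<open>x\<close> and nothing is known about
    \<open>f\<close> outside.\<close>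
  proof (rule Bolzano[where P = "\<lambda>u v. a \<le> u \<and> v \<le> b \<longrightarrow> (\<exists>s. approx u v s)"])
    fix u v w
    assume *: "a \<le> u \<and> v \<le> b \<longrightarrow> (\<exists>s. approx u v s)" "a \<le> v \<and> w \<le> b \<longrightarrow> (\<exists>s. approx v w s)"
      and uvw: "u \<le> v" "v \<le> w"
    show "a \<le> u \<and> w \<le> b \<longrightarrow> (\<exists>s. approx u w s)"
    proof
      assume "a \<le> u \<and> w \<le> b"
      with * uvw obtain s s' where s: "approx u v s" "approx v w s'"
        by (metis order_trans)
      have "approx u w (\<lambda>t. s t + s' t)"
        unfolding approx_def
      proof (intro conjI ballI allI impI)
        show "step_function a b (\<lambda>t. s t + s' t)"
          using s by (auto simp: approx_def intro: step_function.add)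
        show "\<bar>f t - (s t + s' t)\<bar> \<le> e" if "t \<in> {u<..w}" for t
          using s that by (cases "t \<le> v") (auto simp: approx_def)
        show "s t + s' t = 0" if "t \<notin> {u<..w}" for t
          using s that uvw by (auto simp: approx_def)
      qed
      then show "\<exists>s. approx u w s" by blast
    qed
  next
    fix x assume x: "a \<le> x" "x \<le> b"
    have "\<exists>l. \<exists>d>0. a < x \<longrightarrow> (\<forall>y. x - d < y \<and> y < x \<longrightarrow> \<bar>f y - l\<bar> \<le> e)"
    proof (cases "a < x")
      case True
      then obtain l where "(f \<longlongrightarrow> l) (at_left x)"
        using left_lim_tendsto[OF reg] x by fastforce
      then obtain z where "z < x" "\<And>y. z < y \<Longrightarrow> y < x \<Longrightarrow> \<bar>f y - l\<bar> < e"
        using tendstoD[of f l "at_left x", OF _ \<open>e > 0\<close>] eventually_at_left[OF True]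
        by (auto simp: dist_real_def)
      then show ?thesis
        by (intro exI[of _ l] exI[of _ "x - z"]) (auto simp: less_imp_le)
    qed (auto intro: exI[of _ 1])
    then obtain l d where l: "d > 0" "\<And>y. a < x \<Longrightarrow> x - d < y \<Longrightarrow> y < x \<Longrightarrow> \<bar>f y - l\<bar> \<le> e"
      by blast
    have "\<exists>r. \<exists>d>0. x < b \<longrightarrow> (\<forall>y. x < y \<and> y < x + d \<longrightarrow> \<bar>f y - r\<bar> \<le> e)"
    proof (cases "x < b")
      case True
      then obtain r where "(f \<longlongrightarrow> r) (at_right x)"
        using right_lim_tendsto[OF reg] x by fastforce
      then obtain z where "x < z" "\<And>y. x < y \<Longrightarrow> y < z \<Longrightarrow> \<bar>f y - r\<bar> < e"
        using tendstoD[of f r "at_right x", OF _ \<open>e > 0\<close>] eventually_at_right[OF True]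
        by (auto simp: dist_real_def)
      then show ?thesis
        by (intro exI[of _ r] exI[of _ "z - x"]) (auto simp: less_imp_le)
    qed (auto intro: exI[of _ 1])
    then obtain r d' where r: "d' > 0" "\<And>y. x < b \<Longrightarrow> x < y \<Longrightarrow> y < x + d' \<Longrightarrow> \<bar>f y - r\<bar> \<le> e"
      by blast
    have "\<exists>s. approx u v s" if uv: "u \<le> x" "x \<le> v" "v - u < min d d'" "a \<le> u" "v \<le> b" for u v
    proof -
      have mem: "u \<in> {a..b}" "x \<in> {a..b}" "v \<in> {a..b}"
        using uv by auto
      define right where "right = (\<lambda>t. r * (indicator {x<..} t - indicator {v<..} t))"
      define left where "left = (\<lambda>t. l * (indicator {u<..} t - indicator {x..} t)
        + f x * (indicator {x..} t - indicator {x<..} t))"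
      have steps: "step_function a b right" "step_function a b left"
        unfolding right_def left_def
        by (intro step_function.intros step_function_diff mem)+
      have right: "right t = (if x < t \<and> t \<le> v then r else 0)" for t
        using uv(2) by (simp add: right_def indicator_def)
      have near: "\<bar>f t - r\<bar> \<le> e" if "x < t" "t \<le> v" for t
        using r(2)[of t] that uv by auto
      have near': "\<bar>f t - l\<bar> \<le> e" if "u < t" "t < x" for t
        using l(2)[of t] that uv by auto
      show ?thesis
      \<comment> \<open>If \<open>u = x\<close>, the point \<open>x\<close> is outside the half-open
        interval and the approximant must vanish there, so only the right part is taken.\<close>
      proof (cases "u = x")
        case True
        then have "approx u v right"
          using steps(1) near by (auto simp: approx_def right)
        then show ?thesis by blast
      next
        case False
        then have "left t = (if u < t \<and> t < x then l else if t = x then f x else 0)" for t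
          using uv(1) by (simp add: left_def indicator_def)
        then have "approx u v (\<lambda>t. left t + right t)"
          using step_function.add[OF steps(2,1)] near near' uv(1,2) False \<open>e > 0\<close>
          by (auto simp: approx_def right)
        then show ?thesis by blast
      qed
    qed
    then show "\<exists>d>0. \<forall>u v. u \<le> x \<and> x \<le> v \<and> v - u < d \<longrightarrow> (a \<le> u \<and> v \<le> b \<longrightarrow> (\<exists>s. approx u v s))"
      using l(1) r(1) by (intro exI[of _ "min d d'"]) auto
  qed
  then obtain s where s: "approx a b s"
    by auto
  have a: "a \<in> {a..b}"
    using \<open>a < b\<close> by simp
  have "step_function a b (\<lambda>t. s t + f a * (indicator {a..} t - indicator {a<..} t))"
    using s by (intro step_function.intros step_function_diff a) (simp add: approx_def)
  moreover have "\<bar>f t - (s t + f a * (indicator {a..} t - indicator {a<..} t))\<bar> \<le> e"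
    if "t \<in> {a..b}" for t
    using s that \<open>e > 0\<close> by (cases "t = a") (auto simp: approx_def indicator_def)
  ultimately show ?thesis
    by blast
qed

lemma parts_pair_bounded_variation:
  assumes "a < b" "regulated_on a b f" "regulated_on a b g" "has_bounded_variation a b g"
  shows "parts_pair a b f g" "parts_pair a b g f"
proof -
  have "\<exists>s. parts_pair a b s g \<and> parts_pair a b g s \<and> (\<forall>t\<in>{a..b}. \<bar>f t - s t\<bar> \<le> e)" if "e > 0" for e
    using regulated_step_approximation[OF assms(1,2) that] step_function_parts_pair[OF _ assms(1,3)]
    by blast
  from parts_pair_uniform_limit[OF assms(1,4) this]
  show "parts_pair a b f g" "parts_pair a b g f" by auto
qed

section \<open>The Young integral\<close>

lemma sum_pairs:
  fixes h :: "nat \<Rightarrow> real"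
  shows "(\<Sum>i=1..2 * n. h i) = (\<Sum>k<n. h (2 * k + 1) + h (2 * k + 2))"
  by (induction n) auto

text \<open>The Young sum of an interior partition is the limit of Stieltjes sums with one tag at each
  division point, whose cells shrink. Summation by parts turns these into Dushnik sums of
  \<^term>\<open>g\<close> against \<^term>\<open>f\<close> on the division formed by all division points and tags.\<close>

lemma young_sum_limit:
  assumes reg: "regulated_on a b g" and ip: "interior_partition a b B \<nu> \<alpha> \<xi>"
  obtains \<gamma> \<sigma> where "\<And>n. interior_partition a b B (2 * \<nu>) \<gamma> (\<sigma> n)"
    "(\<lambda>n. stieltjes_sum g f (2 * \<nu>) \<gamma> (\<sigma> n)) \<longlonglongrightarrow> f b * g b - f a * g a - young_sum f g \<nu> \<alpha> \<xi>"
proof -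
  \<comment> \<open>The shift by two keeps every term strictly below 1, so that the tags built from
    it are interior from the start.\<close>
  define \<theta> :: "nat \<Rightarrow> real" where "\<theta> = (\<lambda>n. inverse (Suc (Suc n)))"
  have \<theta>: "0 < \<theta> n" "\<theta> n < 1" "\<theta> n \<noteq> 0" for n
    by (auto simp: \<theta>_def field_simps)
  have \<theta>_lim: "\<theta> \<longlonglongrightarrow> 0"
    using LIMSEQ_Suc[OF LIMSEQ_inverse_real_of_nat] by (simp add: \<theta>_def)
  define \<gamma> where "\<gamma> i = (if even i then \<alpha> (i div 2) else \<xi> (Suc (i div 2)))" for i
  \<comment> \<open>Each old division point is approached by the tags of the cells next to it: from
    the right in odd cells, from the left in even ones. This produces the one-sided limits of
    \<open>g\<close>.\<close>
  define \<sigma> where "\<sigma> n i = (if even i then \<alpha> (i div 2) - (\<alpha> (i div 2) - \<xi> (i div 2)) * \<theta> n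
    else \<alpha> (i div 2) + (\<xi> (Suc (i div 2)) - \<alpha> (i div 2)) * \<theta> n)" for n i
  have p: "is_partition a b \<nu> \<alpha> \<xi>"
    using ip by (simp add: interior_partition_def)
  note d = partition_division[OF p]
  have ends: "\<alpha> 0 = a" "\<alpha> \<nu> = b"
    using d by (auto simp: is_division_def)
  have int: "\<alpha> k < \<xi> (Suc k)" "\<xi> (Suc k) < \<alpha> (Suc k)" if "k < \<nu>" for k
    using ip that by (auto simp: interior_partition_def dest: bspec[of _ _ "Suc k"])
  have cell: "\<gamma> (i - 1) < \<sigma> n i \<and> \<sigma> n i < \<gamma> i" if i: "i \<in> {1..2 * \<nu>}" for i n
  proof (cases "even i")
    case True
    then obtain m where "i = 2 * m"
      by (rule evenE)
    then have "i = 2 * Suc (m - 1)" "m - 1 < \<nu>"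
      using i by auto
    then obtain k where "i = 2 * Suc k" "k < \<nu>"
      by blast
    moreover have "(\<alpha> (Suc k) - \<xi> (Suc k)) * \<theta> n < \<alpha> (Suc k) - \<xi> (Suc k)"
      using int[of k] \<theta>[of n] \<open>k < \<nu>\<close> by simp
    then have "\<xi> (Suc k) < \<alpha> (Suc k) - (\<alpha> (Suc k) - \<xi> (Suc k)) * \<theta> n"
      by linarith
    ultimately show ?thesis
      using int[of k] \<theta>[of n] by (simp add: \<gamma>_def \<sigma>_def)
  next
    case False
    then obtain k where k: "i = 2 * k + 1"
      by (rule oddE)
    then have "k < \<nu>"
      using i by auto
    moreover have "(\<xi> (Suc k) - \<alpha> k) * \<theta> n < \<xi> (Suc k) - \<alpha> k"
      using int[of k] \<theta>[of n] \<open>k < \<nu>\<close> by simp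
    then have "\<alpha> k + (\<xi> (Suc k) - \<alpha> k) * \<theta> n < \<xi> (Suc k)"
      by linarith
    ultimately show ?thesis
      using int[of k] \<theta>[of n] k by (simp add: \<gamma>_def \<sigma>_def)
  qed
  have "\<gamma> (i - 1) < \<gamma> i" if "i \<in> {1..2 * \<nu>}" for i
    using cell[OF that, of 0] by linarith
  moreover have "\<gamma> 0 = a" "\<gamma> (2 * \<nu>) = b"
    by (simp_all add: \<gamma>_def ends)
  moreover have "B \<subseteq> \<gamma> ` {0..2 * \<nu>}"
  proof
    fix x assume "x \<in> B"
    then obtain k where "k \<le> \<nu>" "x = \<alpha> k"
      using ip by (force simp: interior_partition_def)
    then show "x \<in> \<gamma> ` {0..2 * \<nu>}"
      by (intro image_eqI[of _ _ "2 * k"]) (auto simp: \<gamma>_def)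
  qed
  ultimately have "interior_partition a b B (2 * \<nu>) \<gamma> (\<sigma> n)" for n
    using cell[of _ n] unfolding interior_partition_def is_partition_def is_division_def
    by (auto simp: less_imp_le)
  moreover have "(\<lambda>n. stieltjes_sum g f (2 * \<nu>) \<gamma> (\<sigma> n)) \<longlonglongrightarrow> f b * g b - f a * g a - young_sum f g \<nu> \<alpha> \<xi>"
  proof -
    have sum: "stieltjes_sum g f (2 * \<nu>) \<gamma> (\<sigma> n) =
      (\<Sum>k<\<nu>. g (\<alpha> k + (\<xi> (Suc k) - \<alpha> k) * \<theta> n) * (f (\<xi> (Suc k)) - f (\<alpha> k))
        + g (\<alpha> (Suc k) - (\<alpha> (Suc k) - \<xi> (Suc k)) * \<theta> n) * (f (\<alpha> (Suc k)) - f (\<xi> (Suc k))))" for n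
      unfolding stieltjes_sum_def sum_pairs by (intro sum.cong) (auto simp: \<gamma>_def \<sigma>_def)
    have right: "(\<lambda>n. g (\<alpha> k + (\<xi> (Suc k) - \<alpha> k) * \<theta> n)) \<longlonglongrightarrow> right_lim g (\<alpha> k)" if k: "k < \<nu>" for k
    proof (rule filterlim_compose[OF right_lim_tendsto[OF reg]])
      show "\<alpha> k \<in> {a..<b}"
        using division_mem[OF d, of k] division_less[OF d, of k \<nu>] ends k by auto
      show "filterlim (\<lambda>n. \<alpha> k + (\<xi> (Suc k) - \<alpha> k) * \<theta> n) (at_right (\<alpha> k)) sequentially"
        unfolding filterlim_at using int[OF k] \<theta>
        by (auto intro!: tendsto_eq_intros \<theta>_lim always_eventually mult_pos_pos simp: less_imp_neq)
    qed
    have left: "(\<lambda>n. g (\<alpha> (Suc k) - (\<alpha> (Suc k) - \<xi> (Suc k)) * \<theta> n)) \<longlonglongrightarrow> left_lim g (\<alpha> (Suc k))"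
      if k: "k < \<nu>" for k
    proof (rule filterlim_compose[OF left_lim_tendsto[OF reg]])
      show "\<alpha> (Suc k) \<in> {a<..b}"
        using division_mem[OF d, of "Suc k"] division_less[OF d, of 0 "Suc k"] ends k by auto
      show "filterlim (\<lambda>n. \<alpha> (Suc k) - (\<alpha> (Suc k) - \<xi> (Suc k)) * \<theta> n) (at_left (\<alpha> (Suc k))) sequentially"
        unfolding filterlim_at using int[OF k] \<theta>
        by (auto intro!: tendsto_eq_intros \<theta>_lim always_eventually mult_pos_pos simp: less_imp_neq)
    qed
    define L where "L = (\<Sum>k<\<nu>. right_lim g (\<alpha> k) * (f (\<xi> (Suc k)) - f (\<alpha> k))
      + left_lim g (\<alpha> (Suc k)) * (f (\<alpha> (Suc k)) - f (\<xi> (Suc k))))"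
    \<comment> \<open>In each cell the one-sided limits cancel, leaving an increment of the product
      of \<open>f\<close> and \<open>g\<close>.\<close>
    have "young_sum f g \<nu> \<alpha> \<xi> + L = (\<Sum>k<\<nu>. f (\<alpha> (Suc k)) * g (\<alpha> (Suc k)) - f (\<alpha> k) * g (\<alpha> k))"
      unfolding young_sum_def L_def One_nat_def sum.atLeast1_atMost_eq sum.distrib[symmetric]
      by (intro sum.cong refl) (simp add: left_jump_def right_jump_def algebra_simps)
    also have "\<dots> = f b * g b - f a * g a"
      using sum_lessThan_telescope[of "\<lambda>k. f (\<alpha> k) * g (\<alpha> k)" \<nu>] ends by simp
    finally have "L = f b * g b - f a * g a - young_sum f g \<nu> \<alpha> \<xi>"
      by simp
    moreover have "(\<lambda>n. stieltjes_sum g f (2 * \<nu>) \<gamma> (\<sigma> n)) \<longlonglongrightarrow> L"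
      unfolding sum L_def using left right by (intro tendsto_intros) auto
    ultimately show ?thesis by simp
  qed
  ultimately show ?thesis
    by (rule that)
qed

text \<open>The refined partitions still contain \<open>B\<close>, so the set that works for the
  Dushnik integral works for the Young integral. Passing to the limit weakens the strict estimate,
  hence \<open>e / 2\<close>.\<close>

lemma dushnik_imp_young:
  assumes reg: "regulated_on a b g" and lim: "(stieltjes g f \<longlongrightarrow> d) (dushnik_filter a b)"
  shows "((\<lambda>(\<nu>, \<alpha>, \<xi>). young_sum f g \<nu> \<alpha> \<xi>) \<longlongrightarrow> f b * g b - f a * g a - d) (dushnik_filter a b)"
proof (rule tendstoI)
  fix e :: real assume "e > 0"
  have "\<forall>\<^sub>F (\<nu>, \<alpha>, \<xi>) in dushnik_filter a b. \<bar>stieltjes_sum g f \<nu> \<alpha> \<xi> - d\<bar> < e / 2"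
    using tendstoD[OF lim, of "e / 2"] \<open>e > 0\<close>
    by (simp add: stieltjes_def dist_real_def case_prod_unfold)
  then obtain B where B: "finite B" "B \<subseteq> {a..b}"
    "\<And>\<nu> \<alpha> \<xi>. interior_partition a b B \<nu> \<alpha> \<xi> \<Longrightarrow> \<bar>stieltjes_sum g f \<nu> \<alpha> \<xi> - d\<bar> < e / 2"
    unfolding eventually_dushnik_filter by blast
  have "\<bar>young_sum f g \<nu> \<alpha> \<xi> - (f b * g b - f a * g a - d)\<bar> < e"
    if ip: "interior_partition a b B \<nu> \<alpha> \<xi>" for \<nu> \<alpha> \<xi>
  proof -
    obtain \<gamma> \<sigma> where q: "\<And>n. interior_partition a b B (2 * \<nu>) \<gamma> (\<sigma> n)"
      "(\<lambda>n. stieltjes_sum g f (2 * \<nu>) \<gamma> (\<sigma> n)) \<longlonglongrightarrow> f b * g b - f a * g a - young_sum f g \<nu> \<alpha> \<xi>"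
      using young_sum_limit[OF reg ip] by blast
    have "\<bar>f b * g b - f a * g a - young_sum f g \<nu> \<alpha> \<xi> - d\<bar> \<le> e / 2"
    proof (rule tendsto_upperbound)
      show "(\<lambda>n. \<bar>stieltjes_sum g f (2 * \<nu>) \<gamma> (\<sigma> n) - d\<bar>)
          \<longlonglongrightarrow> \<bar>f b * g b - f a * g a - young_sum f g \<nu> \<alpha> \<xi> - d\<bar>"
        by (intro tendsto_intros q(2))
      show "\<forall>\<^sub>F n in sequentially. \<bar>stieltjes_sum g f (2 * \<nu>) \<gamma> (\<sigma> n) - d\<bar> \<le> e / 2"
        by (intro always_eventually allI less_imp_le B(3) q(1))
    qed simp
    then show ?thesis
      using \<open>e > 0\<close> by linarith
  qed
  with B(1,2) have "\<forall>\<^sub>F (\<nu>, \<alpha>, \<xi>) in dushnik_filter a b.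
      \<bar>young_sum f g \<nu> \<alpha> \<xi> - (f b * g b - f a * g a - d)\<bar> < e"
    unfolding eventually_dushnik_filter by blast
  then show "\<forall>\<^sub>F P in dushnik_filter a b.
      dist (case P of (\<nu>, \<alpha>, \<xi>) \<Rightarrow> young_sum f g \<nu> \<alpha> \<xi>) (f b * g b - f a * g a - d) < e"
    by eventually_elim (auto simp: dist_real_def)
qed

theorem theorem2p1:
  fixes a b :: real and f g :: "real \<Rightarrow> real"
  assumes "a < b"
    and "regulated_on a b f" and "regulated_on a b g"
    and "has_bounded_variation a b f \<or> has_bounded_variation a b g"
  shows "ks_integrable a b f g \<and> young_integrable a b f g \<and>
         dushnik_integrable a b f g \<and> dushnik_integrable a b g f \<and>
         ks_integral a b f g = young_integral a b f g \<and>
         young_integral a b f g = f b * g b - f a * g a - dushnik_integral a b g f"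
proof -
  \<comment> \<open>Whichever function has bounded variation, both orders follow. The second order
    contributes the Dushnik integral of \<open>f\<close> against \<open>g\<close>.\<close>
  have "parts_pair a b f g" "parts_pair a b g f"
    using assms parts_pair_bounded_variation[of a b f g] parts_pair_bounded_variation[of a b g f]
    by blast+
  then obtain d d' where
    ks: "(stieltjes f g \<longlongrightarrow> f b * g b - f a * g a - d) (ks_filter a b)" and
    dushnik: "(stieltjes g f \<longlongrightarrow> d) (dushnik_filter a b)" "(stieltjes f g \<longlongrightarrow> d') (dushnik_filter a b)"
    by (auto simp: parts_pair_def)
  note young = dushnik_imp_young[OF assms(3) dushnik(1)]
  note nonbot = ks_filter_nonbot[OF less_imp_le[OF assms(1)]] dushnik_filter_nonbot[OF assms(1)]
  note iffs = has_ks_integral_iff has_dushnik_integral_iff[OF assms(1)]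
    has_young_integral_iff[OF assms(1)]
  have "ks_integral a b f g = f b * g b - f a * g a - d"
    unfolding ks_integral_def iffs using ks nonbot by (blast intro: tendsto_unique)
  moreover have "young_integral a b f g = f b * g b - f a * g a - d"
    unfolding young_integral_def iffs using young nonbot by (blast intro: tendsto_unique)
  moreover have "dushnik_integral a b g f = d"
    unfolding dushnik_integral_def iffs using dushnik nonbot by (blast intro: tendsto_unique)
  ultimately show ?thesis
    unfolding ks_integrable_def young_integrable_def dushnik_integrable_def iffs
    using ks young dushnik by auto
qed

end
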